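(* Let $S\in\mathcal{L}^s_{cr}$. Then $C_S$ is equal to the set of all $T\in\mathcal{L}^s_{cr}$ such that $U_S=U_T$ and there exist $\lambda_1,\lambda_2>0$ with $$|S|\leq\lambda_1T^++\lambda_2T^-\quad\text{and}\quad |S|^\dagger\geq\frac{1}{\lambda_1}(T^+)^\dagger+\frac{1}{\lambda_2}(T^-)^\dagger .$$ In particular, if $S\in\mathcal{L}^+_{cr}$, then $$C_S=\Bigl\{T\in\mathcal{L}^+_{cr}:\ S\leq\lambda T\ \text{ and }\ \frac{1}{\lambda}T^\dagger\leq S^\dagger\ \text{ for some }\lambda>0\Bigr\}.$$
   Context: $\mathcal{H}$ is a complex Hilbert space and $\mathcal{L}(\mathcal{H})$ is the algebra of bounded linear operators on $\mathcal{H}$; $\mathcal{R}(A)$, $\mathcal{N}(A)$ denote range and nullspace. $\mathcal{L}^s$ is the set of selfadjoint operators in $\mathcal{L}(\mathcal{H})$, $\mathcal{L}^s_{cr}$ the subset of those with closed range, and $\mathcal{L}^+_{cr}$ the set of positive semidefinite operators in $\mathcal{L}(\mathcal{H})$ with closed range. For selfadjoint $A,B$, $A\leq B$ (Löwner order) means $\langle Ax,x\rangle\leq\langle Bx,x\rangle$ for all $x\in\mathcal{H}$. The positive orthogonal decomposition of $A\in\mathcal{L}^s$ is $A=A^+-A^-$ with $A^+=\frac{|A|+A}{2}$, $A^-=\frac{|A|-A}{2}$, where $|A|=(A^*A)^{1/2}$; if $A$ has closed range, so do $A^+$ and $A^-$. For $A\in\mathcal{L}(\mathcal{H})$ with closed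 range, $A^\dagger\in\mathcal{L}(\mathcal{H})$ is the Moore-Penrose inverse, the unique $X\in\mathcal{L}(\mathcal{H})$ with $AXA=A$, $XAX=X$, $AX=P_{\mathcal{R}(A)}$, $XA=P_{\mathcal{R}(A^* )}$, where $P_{\mathcal{V}}$ denotes the orthogonal projection onto the closed subspace $\mathcal{V}$. The Thompson component of $S\in\mathcal{L}^s$ is $$C_S=\{T\in\mathcal{L}^s:\ \mathcal{R}((T^+)^{1/2})=\mathcal{R}((S^+)^{1/2}),\ \mathcal{R}((T^-)^{1/2})=\mathcal{R}((S^-)^{1/2})\}.$$ For $T\in\mathcal{L}^s$, let $T=V_T|T|$ be the polar decomposition, where $V_T$ is the unique partial isometry with this factorization and $\mathcal{R}(V_T)=\overline{\mathcal{R}(T)}$, $\mathcal{N}(V_T)=\mathcal{N}(T)$. Define the reflection $U_T=V_T+P_{\mathcal{N}(T)}$, which satisfies $U_T=U_T^{-1}=U_T^*$. *)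

theory Defs
  imports "HOL-Analysis.Analysis"
begin

text \<open>
  A complex inner product space is presented as a real inner product space (with its library norm
  and topology) that carries a compatible complex structure: the real inner product is the real
  part of the complex one, so the norm is the usual \<open>sqrt \<langle>x, x\<rangle>\<close>. The complex inner product is
  linear in its first argument.
\<close>

class complex_inner = real_inner +
  fixes scaleC :: "complex \<Rightarrow> 'a \<Rightarrow> 'a"  (infixr \<open>*\<^sub>C\<close> 75)
    and cinner :: "'a \<Rightarrow> 'a \<Rightarrow> complex"
  assumes scaleC_add_right: "c *\<^sub>C (x + y) = c *\<^sub>C x + c *\<^sub>C y"
    and scaleC_add_left: "(c + d) *\<^sub>C x = c *\<^sub>C x + d *\<^sub>C x"
    and scaleC_scaleC: "c *\<^sub>C (d *\<^sub>C x) = (c * d) *\<^sub>C x"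
    and scaleC_complex_of_real: "complex_of_real r *\<^sub>C x = r *\<^sub>R x"
    and cinner_add_left: "cinner (x + y) z = cinner x z + cinner y z"
    and cinner_scaleC_left: "cinner (c *\<^sub>C x) y = c * cinner x y"
    and cinner_commute: "cinner x y = cnj (cinner y x)"
    and inner_eq_Re_cinner: "inner x y = Re (cinner x y)"

class complex_hilbert = complex_inner + complete_space

lemma cinner_self: "cinner x x = complex_of_real ((norm x)\<^sup>2)"
  for x :: "'a::complex_inner"
proof (rule complex_eqI)
  show "Re (cinner x x) = Re (complex_of_real ((norm x)\<^sup>2))"
    by (simp flip: inner_eq_Re_cinner add: power2_norm_eq_inner)
  have "Im (cinner x x) = - Im (cinner x x)"
    by (metis cinner_commute cnj.simps(2))
  then show "Im (cinner x x) = Im (complex_of_real ((norm x)\<^sup>2))"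
    by simp
qed

instantiation complex :: complex_hilbert
begin

definition "scaleC_complex c x = c * (x :: complex)"
definition "cinner_complex x y = x * cnj (y :: complex)"

instance
  by standard
    (simp_all add: scaleC_complex_def cinner_complex_def inner_complex_def scaleR_conv_of_real
      algebra_simps)

end


section \<open>Operators on a complex Hilbert space\<close>

text \<open>
  Library elements of \<open>'a \<Rightarrow>\<^sub>L 'a\<close> are only real-linear; \<open>bounded_ops\<close> is the set of the
  complex-linear ones. All uniquely characterised operators below are required to lie in it.
\<close>

definition bounded_ops :: "('a::complex_hilbert \<Rightarrow>\<^sub>L 'a) set" where
  "bounded_ops = {A :: 'a \<Rightarrow>\<^sub>L 'a. \<forall>c x. A (c *\<^sub>C x) = c *\<^sub>C A x}"

definition null_space :: "('a::complex_hilbert \<Rightarrow>\<^sub>L 'a) \<Rightarrow> 'a set" where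
  "null_space A = {x. A x = 0}"

definition op_adj :: "('a::complex_hilbert \<Rightarrow>\<^sub>L 'a) \<Rightarrow> ('a \<Rightarrow>\<^sub>L 'a)" where
  "op_adj A = (THE B. B \<in> bounded_ops \<and> (\<forall>x y. cinner (A x) y = cinner x (B y)))"

definition selfadj_ops :: "('a::complex_hilbert \<Rightarrow>\<^sub>L 'a) set" where
  "selfadj_ops = {A \<in> bounded_ops. \<forall>x y. cinner (A x) y = cinner x (A y)}"

text \<open>The Loewner order is only used between selfadjoint operators, whose quadratic forms are
  real-valued, so that taking real parts loses nothing.\<close>

definition loewner_le :: "('a::complex_hilbert \<Rightarrow>\<^sub>L 'a) \<Rightarrow> ('a \<Rightarrow>\<^sub>L 'a) \<Rightarrow> bool"
    (infix \<open>\<preceq>\<close> 50) where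
  "A \<preceq> B \<longleftrightarrow> (\<forall>x. Re (cinner (A x) x) \<le> Re (cinner (B x) x))"

definition pos_ops :: "('a::complex_hilbert \<Rightarrow>\<^sub>L 'a) set" where
  "pos_ops = {A \<in> selfadj_ops. 0 \<preceq> A}"

definition selfadj_cr_ops :: "('a::complex_hilbert \<Rightarrow>\<^sub>L 'a) set" where
  "selfadj_cr_ops = {A \<in> selfadj_ops. closed (range A)}"

definition pos_cr_ops :: "('a::complex_hilbert \<Rightarrow>\<^sub>L 'a) set" where
  "pos_cr_ops = {A \<in> pos_ops. closed (range A)}"

definition op_sqrt :: "('a::complex_hilbert \<Rightarrow>\<^sub>L 'a) \<Rightarrow> ('a \<Rightarrow>\<^sub>L 'a)" where
  "op_sqrt A = (THE B. B \<in> pos_ops \<and> B o\<^sub>L B = A)"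

definition op_abs :: "('a::complex_hilbert \<Rightarrow>\<^sub>L 'a) \<Rightarrow> ('a \<Rightarrow>\<^sub>L 'a)" where
  "op_abs A = op_sqrt (op_adj A o\<^sub>L A)"

definition op_pos :: "('a::complex_hilbert \<Rightarrow>\<^sub>L 'a) \<Rightarrow> ('a \<Rightarrow>\<^sub>L 'a)" where
  "op_pos A = (1/2) *\<^sub>R (op_abs A + A)"

definition op_neg :: "('a::complex_hilbert \<Rightarrow>\<^sub>L 'a) \<Rightarrow> ('a \<Rightarrow>\<^sub>L 'a)" where
  "op_neg A = (1/2) *\<^sub>R (op_abs A - A)"

text \<open>Orthogonal projection; meaningful when \<open>V\<close> is a closed complex subspace.\<close>

definition op_proj :: "'a::complex_hilbert set \<Rightarrow> ('a \<Rightarrow>\<^sub>L 'a)" where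
  "op_proj V = (THE P. P \<in> bounded_ops \<and> (\<forall>x. P x \<in> V \<and> (\<forall>v\<in>V. cinner (x - P x) v = 0)))"

text \<open>Moore-Penrose inverse; meaningful when \<open>A\<close> has closed range.\<close>

definition op_pinv :: "('a::complex_hilbert \<Rightarrow>\<^sub>L 'a) \<Rightarrow> ('a \<Rightarrow>\<^sub>L 'a)" where
  "op_pinv A = (THE X. X \<in> bounded_ops \<and>
     A o\<^sub>L X o\<^sub>L A = A \<and> X o\<^sub>L A o\<^sub>L X = X \<and>
     A o\<^sub>L X = op_proj (range A) \<and> X o\<^sub>L A = op_proj (range (op_adj A)))"

definition partial_isometry :: "('a::complex_hilbert \<Rightarrow>\<^sub>L 'a) \<Rightarrow> bool" where
  "partial_isometry V \<longleftrightarrow> V \<in> bounded_ops \<and>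
     (\<forall>x. (\<forall>y\<in>null_space V. cinner x y = 0) \<longrightarrow> norm (V x) = norm x)"

definition polar_factor :: "('a::complex_hilbert \<Rightarrow>\<^sub>L 'a) \<Rightarrow> ('a \<Rightarrow>\<^sub>L 'a)" where
  "polar_factor T = (THE V. partial_isometry V \<and> T = V o\<^sub>L op_abs T \<and>
     range V = closure (range T) \<and> null_space V = null_space T)"

definition op_reflection :: "('a::complex_hilbert \<Rightarrow>\<^sub>L 'a) \<Rightarrow> ('a \<Rightarrow>\<^sub>L 'a)" where
  "op_reflection T = polar_factor T + op_proj (null_space T)"

definition thompson_component :: "('a::complex_hilbert \<Rightarrow>\<^sub>L 'a) \<Rightarrow> ('a \<Rightarrow>\<^sub>L 'a) set" where
  "thompson_component S = {T \<in> selfadj_ops.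
     range (op_sqrt (op_pos T)) = range (op_sqrt (op_pos S)) \<and>
     range (op_sqrt (op_neg T)) = range (op_sqrt (op_neg S))}"

end

theory Submission
  imports Defs
begin

text \<open>
  For closed-range \<open>S\<close> the square roots can be dropped: \<open>T\<close> lies in the component of \<open>S\<close> iff
  \<open>T\<^sup>+\<close>, \<open>S\<^sup>+\<close> and \<open>T\<^sup>-\<close>, \<open>S\<^sup>-\<close> have the same (closed) ranges. The reflection of \<open>T\<close> is
  \<open>P\<^sub>+ - P\<^sub>- + P\<^sub>0\<close>, where \<open>P\<^sub>+\<close>, \<open>P\<^sub>-\<close>, \<open>P\<^sub>0\<close> are the projections onto the ranges of \<open>T\<^sup>+\<close>, \<open>T\<^sup>-\<close>
  and the null space; as they sum to the identity, the reflection and the null space together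
  determine the two ranges. It remains to see that the two inequalities say that \<open>S\<close> and \<open>T\<close> have
  the same null space. Each inequality gives one inclusion of null spaces, and conversely a positive
  operator is dominated by a multiple of any closed-range positive operator with smaller null space,
  because the latter is bounded below on its range.
\<close>

subsection \<open>Orthogonal projection and weak boundedness\<close>

text \<open>Roots, projections, pseudoinverses and polar factors are definite descriptions
  (\<open>THE\<close>), so each needs existence and uniqueness before anything can be said about it.
  The existence proofs run in the underlying real Hilbert space, with symmetry and positivity stated
  for \<open>inner\<close>; complex linearity is recovered afterwards, for roots from commutation
  with scalar multiplication, for projections and pseudoinverses from uniqueness. No spectral
  calculus is used. Its role for the two parts of \<open>T\<close> is taken by algebra:
  \<open>op_pos T\<close> and \<open>op_neg T\<close> have sum \<open>op_abs T\<close>, difference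
  \<open>T\<close> and product zero, and positivity of the parts, closedness of their ranges and the
  splitting of the space follow from this. The quantitative input is the lower bound of a
  closed-range symmetric operator on its range, which rests on the Baire category theorem. It makes
  the Moore-Penrose inverse bounded and supplies the constants in the inequalities, where a single
  number can serve for both.\<close>

lemma orthogonal_decomposition:
  fixes V :: "'a::{real_inner,banach} set"
  assumes V: "subspace V" "closed V"
  obtains u where "u \<in> V" "\<And>v. v \<in> V \<Longrightarrow> inner (x - u) v = 0"
proof -
  define q where "q = (INF v\<in>V. (norm (x - v))\<^sup>2)"
  have bdd: "bdd_below ((\<lambda>v. (norm (x - v))\<^sup>2) ` V)"
    by (rule bdd_belowI2[where m = 0]) simp
  have q_le: "q \<le> (norm (x - v))\<^sup>2" if "v \<in> V" for v
    unfolding q_def by (rule cINF_lower[OF bdd that])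
  have ne: "V \<noteq> {}" using subspace_0[OF V(1)] by auto
  have "\<exists>v\<in>V. (norm (x - v))\<^sup>2 < q + 1 / real (Suc n)" for n
    using cInf_lessD[of "(\<lambda>v. (norm (x - v))\<^sup>2) ` V" "q + 1 / real (Suc n)"] ne
    unfolding q_def by auto
  then obtain w where w: "\<And>n. w n \<in> V" "\<And>n. (norm (x - w n))\<^sup>2 < q + 1 / real (Suc n)"
    by metis
  \<comment> \<open>Parallelogram law: the midpoint of \<open>a\<close> and \<open>b\<close> lies in
    \<open>V\<close>, so its squared distance from \<open>x\<close> is at least \<open>q\<close>.
    Almost minimal points are therefore close to each other.\<close>
  have par: "(norm (a - b))\<^sup>2 \<le> 2 * (norm (x - a))\<^sup>2 + 2 * (norm (x - b))\<^sup>2 - 4 * q"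
    if "a \<in> V" "b \<in> V" for a b
  proof -
    have "(1/2) *\<^sub>R (a + b) \<in> V"
      using that V(1) by (simp add: subspace_add subspace_scale)
    from q_le[OF this]
    have "q \<le> (norm (x - (1/2) *\<^sub>R (a + b)))\<^sup>2" .
    moreover have "(norm (a - b))\<^sup>2
        = 2 * (norm (x - a))\<^sup>2 + 2 * (norm (x - b))\<^sup>2 - 4 * (norm (x - (1/2) *\<^sub>R (a + b)))\<^sup>2"
      by (simp add: power2_norm_eq_inner inner_simps inner_commute algebra_simps)
    ultimately show ?thesis by linarith
  qed
  have cau: "Cauchy w"
  proof (rule metric_CauchyI)
    fix e :: real assume e: "e > 0"
    obtain N where N: "1 / real (Suc N) < e\<^sup>2 / 4"
      using reals_Archimedean[of "e\<^sup>2 / 4"] e by (auto simp: inverse_eq_divide)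
    have small: "1 / real (Suc n) < e\<^sup>2 / 4" if "n \<ge> N" for n
      by (rule le_less_trans[OF _ N]) (use that in \<open>simp add: frac_le\<close>)
    have "dist (w m) (w n) < e" if "m \<ge> N" "n \<ge> N" for m n
    proof -
      have "(norm (w m - w n))\<^sup>2 < e\<^sup>2"
        using par[OF w(1) w(1), of m n] w(2)[of m] w(2)[of n] small[OF that(1)] small[OF that(2)]
        by linarith
      then show ?thesis
        using e by (simp add: dist_norm power_less_imp_less_base)
    qed
    then show "\<exists>M. \<forall>m\<ge>M. \<forall>n\<ge>M. dist (w m) (w n) < e" by blast
  qed
  then obtain u where u: "w \<longlonglongrightarrow> u"
    using Cauchy_convergent_iff convergent_def by blast
  have uV: "u \<in> V" using V(2) u w(1) closed_sequentially by blast
  have "(\<lambda>n. (norm (x - w n))\<^sup>2) \<longlonglongrightarrow> (norm (x - u))\<^sup>2"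
    by (intro tendsto_intros u)
  moreover have "(\<lambda>n. q + 1 / real (Suc n)) \<longlonglongrightarrow> q + 0"
    by (intro tendsto_intros LIMSEQ_Suc[OF lim_1_over_n])
  ultimately have le: "(norm (x - u))\<^sup>2 \<le> q"
    unfolding add_0_right by (rule LIMSEQ_le) (use w(2) less_imp_le in blast)
  have "inner (x - u) v = 0" if v: "v \<in> V" for v
  proof (cases "v = 0")
    case False
    \<comment> \<open>The minimiser of the squared norm of \<open>x - u - t *\<^sub>R v\<close> over
      \<open>t\<close>. Moving there would lower the squared distance by
      \<open>(inner (x - u) v)\<^sup>2 / (norm v)\<^sup>2\<close>, which minimality forces to
      vanish.\<close>
    define t where "t = inner (x - u) v / (norm v)\<^sup>2"
    have "u + t *\<^sub>R v \<in> V" using uV v V(1) by (simp add: subspace_add subspace_scale)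
    from q_le[OF this] le have "(norm (x - u))\<^sup>2 \<le> (norm (x - u - t *\<^sub>R v))\<^sup>2"
      unfolding diff_diff_eq by linarith
    also have "\<dots> = (norm (x - u))\<^sup>2 - 2 * t * inner (x - u) v + t\<^sup>2 * (norm v)\<^sup>2"
      unfolding power2_norm_eq_inner inner_diff_left inner_diff_right inner_scaleR_left
        inner_scaleR_right
      by (simp add: inner_commute algebra_simps power2_eq_square)
    also have "t\<^sup>2 * (norm v)\<^sup>2 = t * inner (x - u) v"
      using False by (simp add: t_def power2_eq_square)
    finally have "t * inner (x - u) v \<le> 0" by simp
    moreover have "t * inner (x - u) v = (inner (x - u) v)\<^sup>2 / (norm v)\<^sup>2"
      by (simp add: t_def power2_eq_square)
    ultimately have "(inner (x - u) v)\<^sup>2 / (norm v)\<^sup>2 \<le> 0" by simp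
    then show ?thesis using False by (simp add: divide_le_0_iff)
  qed auto
  with uV that show ?thesis by blast
qed

text \<open>The uniform boundedness principle for the functionals \<open>inner z\<close>: the closed
  sets \<open>F n\<close> cover the space, so by Baire one of them contains a ball, and a bound on a
  ball bounds the norms.\<close>

lemma weakly_bounded_imp_bounded:
  fixes Z :: "'a::{real_inner,banach} set"
  assumes wb: "\<And>y. \<exists>M. \<forall>z\<in>Z. \<bar>inner z y\<bar> \<le> M"
  obtains K where "\<And>z. z \<in> Z \<Longrightarrow> norm z \<le> K"
proof -
  define F where "F = (\<lambda>n::nat. \<Inter>z\<in>Z. {y. \<bar>inner z y\<bar> \<le> real n})"
  have clF: "closed (F n)" for n
    unfolding F_def by (intro closed_INT ballI closed_Collect_le continuous_intros)
  have "\<exists>n. y \<in> F n" for y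
  proof -
    obtain M where M: "\<forall>z\<in>Z. \<bar>inner z y\<bar> \<le> M" using wb by blast
    obtain n where "M \<le> real n" using real_arch_simple by blast
    then show ?thesis using M unfolding F_def by (intro exI[of _ n]) force
  qed
  then have U: "\<Union>(range F) = UNIV" by blast
  have "\<exists>n. interior (F n) \<noteq> {}"
  proof (rule ccontr)
    assume "\<not> ?thesis"
    then have "euclidean interior_of \<Union>(range F) = {}"
      by (intro Baire_category_alt)
        (auto simp: completely_metrizable_space_euclidean euclidean_interior_of clF)
    then show False using U by (simp add: euclidean_interior_of)
  qed
  then obtain n y0 where "y0 \<in> interior (F n)" by blast
  then obtain r where r: "r > 0" "cball y0 r \<subseteq> F n"
    by (meson mem_interior_cball)
  have "norm z \<le> 2 * real n / r" if z: "z \<in> Z" for z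
  proof (cases "z = 0")
    case False
    \<comment> \<open>A step of length \<open>r\<close> from \<open>y0\<close> in the direction of
      \<open>z\<close>. The functional changes by exactly \<open>r * norm z\<close> between two
      points where it is at most \<open>n\<close> in absolute value.\<close>
    define y where "y = y0 + (r / norm z) *\<^sub>R z"
    have "y \<in> cball y0 r" using False r by (simp add: y_def dist_norm)
    moreover have "y0 \<in> cball y0 r" using r by simp
    ultimately have "y \<in> F n" "y0 \<in> F n" using r(2) by blast+
    then have "\<bar>inner z y\<bar> \<le> real n" "\<bar>inner z y0\<bar> \<le> real n"
      using z by (simp_all add: F_def)
    moreover have "inner z y = inner z y0 + r * norm z"
      using False by (simp add: y_def inner_simps dot_square_norm power2_eq_square)
    ultimately have "r * norm z \<le> 2 * real n" by linarith
    then show ?thesis using r by (simp add: pos_le_divide_eq mult.commute)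
  qed (use r in simp)
  with that show ?thesis by blast
qed

subsection \<open>Square roots of positive operators\<close>

definition sym_op :: "('a::real_inner \<Rightarrow>\<^sub>L 'a) \<Rightarrow> bool" where
  "sym_op A \<longleftrightarrow> (\<forall>x y. inner (A x) y = inner x (A y))"

text \<open>Symmetry is a separate conjunct because over the reals a nonnegative quadratic form does
  not imply it.\<close>

definition psd_op :: "('a::real_inner \<Rightarrow>\<^sub>L 'a) \<Rightarrow> bool" where
  "psd_op A \<longleftrightarrow> sym_op A \<and> (\<forall>x. 0 \<le> inner (A x) x)"

lemma sym_opD: "sym_op A \<Longrightarrow> inner (A x) y = inner x (A y)"
  by (simp add: sym_op_def)

lemma psd_opD: "psd_op A \<Longrightarrow> 0 \<le> inner (A x) x"
  by (simp add: psd_op_def)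

lemma psd_op_sym: "psd_op A \<Longrightarrow> sym_op A"
  by (simp add: psd_op_def)

lemma psd_op_scaleR:
  assumes "psd_op A" "0 \<le> c"
  shows "psd_op (c *\<^sub>R A)"
  using assms by (auto simp: psd_op_def sym_op_def blinfun.scaleR_left)

lemma psd_op_square: "sym_op A \<Longrightarrow> psd_op (A o\<^sub>L A)"
  using inner_ge_zero[of "A _"] by (auto simp: psd_op_def sym_op_def)

lemma psd_op_Cauchy_Schwarz:
  assumes A: "psd_op A"
  shows "(inner (A x) y)\<^sup>2 \<le> inner (A x) x * inner (A y) y"
proof -
  let ?a = "inner (A x) x" and ?b = "inner (A x) y" and ?c = "inner (A y) y"
  have poly: "0 \<le> ?a + 2 * t * ?b + t\<^sup>2 * ?c" for t
  proof -
    have "inner (A y) x = ?b"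
      using sym_opD[OF psd_op_sym[OF A], of y x] by (simp add: inner_commute)
    then have "inner (A (x + t *\<^sub>R y)) (x + t *\<^sub>R y) = ?a + 2 * t * ?b + t\<^sup>2 * ?c"
      by (simp add: blinfun.bilinear_simps inner_simps algebra_simps power2_eq_square)
    then show ?thesis using psd_opD[OF A, of "x + t *\<^sub>R y"] by simp
  qed
  show ?thesis
  proof (cases "?c = 0")
    case True
    have "?b = 0"
    proof (rule ccontr)
      assume "?b \<noteq> 0"
      \<comment> \<open>With \<open>?c = 0\<close> the polynomial is affine in \<open>t\<close>, and
        this choice gives it the value -1.\<close>
      then show False using poly[of "- (?a + 1) / (2 * ?b)"] True by (simp add: field_simps)
    qed
    then show ?thesis using True by simp
  next
    case False
    then have "?c > 0" using psd_opD[OF A, of y] by simp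
    moreover have "0 \<le> ?a - ?b\<^sup>2 / ?c"
      using poly[of "- ?b / ?c"] False by (simp add: power2_eq_square field_simps)
    ultimately show ?thesis by (simp add: field_simps)
  qed
qed

text \<open>Cauchy-Schwarz for the form of \<open>A\<close>, taken at \<open>x\<close> and
  \<open>A x\<close>, with one factor \<open>(norm (A x))\<^sup>2\<close> cancelled. Hence a zero of
  the quadratic form is already a null vector.\<close>

lemma psd_op_norm_power2_le:
  assumes A: "psd_op A"
  shows "(norm (A x))\<^sup>2 \<le> norm A * inner (A x) x"
proof (cases "A x = 0")
  case False
  have "(norm (A x))\<^sup>2 * (norm (A x))\<^sup>2 \<le> inner (A x) x * inner (A (A x)) (A x)"
    using psd_op_Cauchy_Schwarz[OF A, of x "A x"] by (simp only: dot_square_norm power2_eq_square)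
  moreover have "inner (A (A x)) (A x) \<le> norm A * (norm (A x))\<^sup>2"
    using norm_cauchy_schwarz[of "A (A x)" "A x"] norm_blinfun[of A "A x"]
    by (smt (verit) mult.assoc mult_right_mono norm_ge_zero power2_eq_square)
  then have "inner (A x) x * inner (A (A x)) (A x) \<le> inner (A x) x * (norm A * (norm (A x))\<^sup>2)"
    by (rule mult_left_mono) (rule psd_opD[OF A])
  ultimately have "(norm (A x))\<^sup>2 * (norm (A x))\<^sup>2 \<le> (norm A * inner (A x) x) * (norm (A x))\<^sup>2"
    by (simp only: mult_ac)
  then show ?thesis by (rule mult_right_le_imp_le) (use False in simp)
qed simp

lemma psd_op_inner_eq_0D: "psd_op A \<Longrightarrow> inner (A x) x = 0 \<Longrightarrow> A x = 0"
  using psd_op_norm_power2_le[of A x] by simp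

lemma norm_id_minus_psd_op_le:
  fixes A :: "'a::real_inner \<Rightarrow>\<^sub>L 'a"
  assumes A: "psd_op A" "norm A \<le> 1"
  shows "norm (id_blinfun - A) \<le> 1"
proof (rule norm_blinfun_bound)
  fix x
  have "(norm (A x))\<^sup>2 \<le> inner (A x) x"
    using psd_op_norm_power2_le[OF A(1), of x] mult_right_mono[OF A(2) psd_opD[OF A(1), of x]]
    by simp
  moreover have "(norm (x - A x))\<^sup>2 = (norm x)\<^sup>2 - 2 * inner (A x) x + (norm (A x))\<^sup>2"
    by (simp add: power2_norm_eq_inner inner_simps inner_commute)
  ultimately have "(norm (x - A x))\<^sup>2 \<le> (norm x)\<^sup>2"
    using psd_opD[OF A(1), of x] by linarith
  then show "norm ((id_blinfun - A) x) \<le> 1 * norm x"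
    using power2_le_imp_le[OF _ norm_ge_zero] by (simp add: blinfun.diff_left)
qed simp

lemmas blinfun_compose_simps =
  bounded_bilinear.add_left[OF bounded_bilinear_blinfun_compose]
  bounded_bilinear.add_right[OF bounded_bilinear_blinfun_compose]
  bounded_bilinear.diff_left[OF bounded_bilinear_blinfun_compose]
  bounded_bilinear.diff_right[OF bounded_bilinear_blinfun_compose]
  bounded_bilinear.scaleR_left[OF bounded_bilinear_blinfun_compose]
  bounded_bilinear.scaleR_right[OF bounded_bilinear_blinfun_compose]

lemma blinfun_compose_assoc: "(A o\<^sub>L B) o\<^sub>L C = A o\<^sub>L (B o\<^sub>L C)"
  by (rule blinfun_eqI) simp

lemma sym_op_limit:
  fixes Y :: "nat \<Rightarrow> 'a::real_inner \<Rightarrow>\<^sub>L 'a"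
  assumes "Y \<longlonglongrightarrow> L" "\<And>n. sym_op (Y n)"
  shows "sym_op L"
  unfolding sym_op_def
proof (intro allI)
  fix x y
  have "(\<lambda>n. inner (Y n x) y) \<longlonglongrightarrow> inner (L x) y" "(\<lambda>n. inner x (Y n y)) \<longlonglongrightarrow> inner x (L y)"
    by (intro tendsto_intros assms(1) blinfun.tendsto)+
  moreover have "(\<lambda>n. inner (Y n x) y) = (\<lambda>n. inner x (Y n y))"
    using assms(2) by (simp add: sym_op_def)
  ultimately show "inner (L x) y = inner x (L y)" using LIMSEQ_unique by metis
qed

text \<open>With \<open>B = 1 - A\<close>, the square root is \<open>1 - Y\<close> where \<open>Y = (B + Y\<^sup>2) / 2\<close>. The iteration for \<open>Y\<close>
  is dominated in norm by the scalar iteration with \<open>B\<close> replaced by \<open>1\<close>, which increases to \<open>1\<close>.\<close>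

lemma psd_op_sqrt_exists_aux:
  fixes A :: "'a::{real_inner,banach} \<Rightarrow>\<^sub>L 'a"
  assumes A: "psd_op A" "norm A \<le> 1"
  shows "\<exists>X. psd_op X \<and> X o\<^sub>L X = A \<and> (\<forall>C. C o\<^sub>L A = A o\<^sub>L C \<longrightarrow> C o\<^sub>L X = X o\<^sub>L C)"
proof -
  define B where "B = id_blinfun - A"
  define Y where "Y = rec_nat (0 :: 'a \<Rightarrow>\<^sub>L 'a) (\<lambda>_ Z. (1/2) *\<^sub>R (B + (Z o\<^sub>L Z)))"
  define y where "y = rec_nat (0 :: real) (\<lambda>_ z. (1 + z\<^sup>2) / 2)"
  have Y0: "Y 0 = 0" and YS: "Y (Suc n) = (1/2) *\<^sub>R (B + (Y n o\<^sub>L Y n))" for n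
    by (simp_all add: Y_def)
  have y0: "y 0 = 0" and yS: "y (Suc n) = (1 + (y n)\<^sup>2) / 2" for n
    by (simp_all add: y_def)
  have nB: "norm B \<le> 1" unfolding B_def by (rule norm_id_minus_psd_op_le[OF A])
  have symB: "sym_op B" using psd_op_sym[OF A(1)]
    by (simp add: sym_op_def B_def blinfun.bilinear_simps inner_simps)
  have y01: "0 \<le> y n \<and> y n \<le> 1" for n
    by (induction n) (auto simp: y0 yS power_le_one)
  have y_mono: "y n \<le> y (Suc n)" for n
  proof -
    have "y (Suc n) - y n = (1 - y n)\<^sup>2 / 2"
      by (simp add: yS power2_eq_square field_simps)
    then show ?thesis
      by (metis diff_ge_0_iff_ge zero_le_divide_iff zero_le_numeral zero_le_power2)
  qed
  have nY: "norm (Y n) \<le> y n" for n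
  proof (induction n)
    case (Suc n)
    have "norm (Y n o\<^sub>L Y n) \<le> (y n)\<^sup>2"
      using norm_blinfun_compose[of "Y n" "Y n"] mult_mono[OF Suc Suc] y01[of n]
      by (simp add: power2_eq_square)
    then have "norm (B + (Y n o\<^sub>L Y n)) \<le> 1 + (y n)\<^sup>2"
      using nB norm_triangle_ineq[of B "Y n o\<^sub>L Y n"] by linarith
    then show ?case by (simp add: YS yS)
  qed (simp add: Y0 y0)
  have step: "norm (Y (Suc n) - Y n) \<le> y (Suc n) - y n" for n
  proof (induction n)
    case 0
    show ?case using nB by (simp add: Y0 YS y0 yS)
  next
    case (Suc n)
    let ?D = "Y (Suc n) - Y n"
    have "Y (Suc (Suc n)) - Y (Suc n)
        = (1/2) *\<^sub>R (B + (Y (Suc n) o\<^sub>L Y (Suc n))) - (1/2) *\<^sub>R (B + (Y n o\<^sub>L Y n))"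
      by (rule arg_cong2[where f = minus]) (rule YS)+
    also have "\<dots> = (1/2) *\<^sub>R ((Y (Suc n) o\<^sub>L Y (Suc n)) - (Y n o\<^sub>L Y n))"
      unfolding scaleR_diff_right[symmetric] by simp
    \<comment> \<open>This factorisation of a difference of squares keeps the order of the factors,
      so it holds without commutativity. The scalar increments factor in the same way.\<close>
    also have "(Y (Suc n) o\<^sub>L Y (Suc n)) - (Y n o\<^sub>L Y n) = (Y (Suc n) o\<^sub>L ?D) + (?D o\<^sub>L Y n)"
      by (simp add: blinfun_compose_simps)
    finally have "Y (Suc (Suc n)) - Y (Suc n) = (1/2) *\<^sub>R ((Y (Suc n) o\<^sub>L ?D) + (?D o\<^sub>L Y n))" .
    moreover have "norm ((Y (Suc n) o\<^sub>L ?D) + (?D o\<^sub>L Y n))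
        \<le> y (Suc n) * (y (Suc n) - y n) + (y (Suc n) - y n) * y n"
    proof (rule norm_triangle_le, rule add_mono)
      show "norm (Y (Suc n) o\<^sub>L ?D) \<le> y (Suc n) * (y (Suc n) - y n)"
        by (rule order_trans[OF norm_blinfun_compose]) (rule mult_mono[OF nY Suc], use y01 in auto)
      show "norm (?D o\<^sub>L Y n) \<le> (y (Suc n) - y n) * y n"
        by (rule order_trans[OF norm_blinfun_compose])
          (rule mult_mono[OF Suc nY], use y01 y_mono in auto)
    qed
    moreover have "y (Suc n) * (y (Suc n) - y n) + (y (Suc n) - y n) * y n
        = 2 * (y (Suc (Suc n)) - y (Suc n))"
      using yS[of n] unfolding yS[of "Suc n"] by (simp add: power2_eq_square algebra_simps)
    ultimately show ?case by simp
  qed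
  have diff: "norm (Y (n + k) - Y n) \<le> y (n + k) - y n" for n k
  proof (induction k)
    case (Suc k)
    then show ?case using step[of "n + k"]
        norm_triangle_ineq[of "Y (Suc (n+k)) - Y (n+k)" "Y (n+k) - Y n"]
      by simp
  qed simp
  have "incseq y" using y_mono by (rule incseq_SucI)
  then have "convergent y"
    using incseq_convergent[of y 1] y01 convergent_def by blast
  then have cauy: "Cauchy y" by (rule convergent_Cauchy)
  have "Cauchy Y"
  proof (rule CauchyI')
    fix e :: real assume "0 < e"
    then obtain M where M: "\<forall>m\<ge>M. \<forall>n\<ge>M. norm (y m - y n) < e" using cauy CauchyD by blast
    show "\<exists>M. \<forall>m\<ge>M. \<forall>n>m. dist (Y m) (Y n) < e"
    proof (intro exI allI impI)
      fix m n assume "m \<ge> M" "n > m"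
      then have "norm (Y n - Y m) \<le> y n - y m" "norm (y n - y m) < e"
        using diff[of m "n - m"] M by auto
      then show "dist (Y m) (Y n) < e" by (simp add: dist_norm norm_minus_commute)
    qed
  qed
  then have "convergent Y" by (rule Cauchy_convergent)
  then obtain L where L: "Y \<longlonglongrightarrow> L" unfolding convergent_def by blast
  have "(\<lambda>n. Y (Suc n)) \<longlonglongrightarrow> (1/2) *\<^sub>R (B + (L o\<^sub>L L))"
    unfolding YS by (intro tendsto_intros bounded_bilinear.tendsto[OF bounded_bilinear_blinfun_compose] L)
  then have Leq: "L = (1/2) *\<^sub>R (B + (L o\<^sub>L L))"
    by (rule LIMSEQ_unique[OF LIMSEQ_Suc[OF L]])
  have "norm (Y n) \<le> 1" for n using nY[of n] y01[of n] by linarith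
  then have nL: "norm L \<le> 1" using LIMSEQ_le_const2[OF tendsto_norm[OF L]] by blast
  have symY: "sym_op (Y n)" for n
    by (induction n)
      (use symB in \<open>auto simp: Y0 YS sym_op_def blinfun.add_left blinfun.scaleR_left
        inner_add_left inner_add_right\<close>)
  have symL: "sym_op L" by (rule sym_op_limit[OF L symY])
  define X where "X = id_blinfun - L"
  have "psd_op X"
    unfolding psd_op_def
  proof (intro conjI allI)
    show "sym_op X" using symL by (simp add: X_def sym_op_def blinfun.bilinear_simps inner_simps)
    fix x
    have "inner (L x) x \<le> norm L * norm x * norm x"
      using norm_cauchy_schwarz[of "L x" x] norm_blinfun[of L x]
      by (smt (verit) mult_right_mono norm_ge_zero)
    also have "\<dots> \<le> inner x x"
      using mult_right_mono[OF nL, of "(norm x)\<^sup>2"]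
      by (simp add: power2_norm_eq_inner[symmetric] power2_eq_square)
    finally show "0 \<le> inner (X x) x" by (simp add: X_def blinfun.bilinear_simps inner_simps)
  qed
  moreover have "X o\<^sub>L X = A"
  proof (rule blinfun_eqI)
    fix x
    have "L x = (1/2) *\<^sub>R (x - A x + L (L x))"
      using arg_cong[OF Leq, of "\<lambda>T. blinfun_apply T x"] by (simp add: B_def blinfun.bilinear_simps)
    then have "L x + L x = x - A x + L (L x)"
      by (metis scaleR_2 scaleR_half_double scaleR_add_right)
    then show "(X o\<^sub>L X) x = A x" by (simp add: X_def blinfun.bilinear_simps algebra_simps)
  qed
  \<comment> \<open>Whatever commutes with \<open>A\<close> commutes with each iterate, since these
    are built from \<open>A\<close> by sums and squares, and then with the limit.\<close>
  moreover have "C o\<^sub>L X = X o\<^sub>L C" if C: "C o\<^sub>L A = A o\<^sub>L C" for C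
  proof -
    have idc: "C o\<^sub>L id_blinfun = id_blinfun o\<^sub>L C" by (rule blinfun_eqI) simp
    have CB: "C o\<^sub>L B = B o\<^sub>L C" using C idc by (simp add: B_def blinfun_compose_simps)
    have CY: "C o\<^sub>L Y n = Y n o\<^sub>L C" for n
    proof (induction n)
      case (Suc n)
      have "C o\<^sub>L (Y n o\<^sub>L Y n) = (Y n o\<^sub>L Y n) o\<^sub>L C"
        by (metis Suc blinfun_compose_assoc)
      then show ?case by (simp add: YS blinfun_compose_simps CB)
    qed (auto simp: Y0 intro: blinfun_eqI)
    have "(\<lambda>n. C o\<^sub>L Y n) \<longlonglongrightarrow> (C o\<^sub>L L)" "(\<lambda>n. Y n o\<^sub>L C) \<longlonglongrightarrow> (L o\<^sub>L C)"
      by (intro bounded_bilinear.tendsto[OF bounded_bilinear_blinfun_compose] tendsto_const L)+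
    then have "C o\<^sub>L L = L o\<^sub>L C" unfolding CY using LIMSEQ_unique by blast
    then show ?thesis using idc by (simp add: X_def blinfun_compose_simps)
  qed
  ultimately show ?thesis by blast
qed

text \<open>Scaling reduces to norm at most 1. The commutation clause is exported because uniqueness
  of the root, its complex linearity and the commutation of \<open>T\<close> with
  \<open>op_abs T\<close> all come from it.\<close>

lemma psd_op_sqrt_exists:
  fixes A :: "'a::{real_inner,banach} \<Rightarrow>\<^sub>L 'a"
  assumes A: "psd_op A"
  obtains X where "psd_op X" "X o\<^sub>L X = A" "\<And>C. C o\<^sub>L A = A o\<^sub>L C \<Longrightarrow> C o\<^sub>L X = X o\<^sub>L C"
proof (cases "A = 0")
  case True
  show ?thesis
  proof (rule that[of 0])
    show "psd_op (0 :: 'a \<Rightarrow>\<^sub>L 'a)" by (simp add: psd_op_def sym_op_def)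
  qed (auto simp: True intro: blinfun_eqI)
next
  case False
  define A' where "A' = (1 / norm A) *\<^sub>R A"
  have "psd_op A'"
    unfolding A'_def by (rule psd_op_scaleR[OF A]) simp
  moreover have "norm A' \<le> 1" by (simp add: A'_def)
  ultimately obtain X where X: "psd_op X" "X o\<^sub>L X = A'"
      "\<And>C. C o\<^sub>L A' = A' o\<^sub>L C \<Longrightarrow> C o\<^sub>L X = X o\<^sub>L C"
    using psd_op_sqrt_exists_aux by blast
  show ?thesis
  proof (rule that[of "sqrt (norm A) *\<^sub>R X"])
    show "psd_op (sqrt (norm A) *\<^sub>R X)"
      by (rule psd_op_scaleR[OF X(1)]) simp
    show "(sqrt (norm A) *\<^sub>R X) o\<^sub>L (sqrt (norm A) *\<^sub>R X) = A"
      using False by (simp add: blinfun_compose_simps X(2) A'_def)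
    fix C assume "C o\<^sub>L A = A o\<^sub>L C"
    then have "C o\<^sub>L A' = A' o\<^sub>L C" by (simp add: A'_def blinfun_compose_simps)
    then show "C o\<^sub>L (sqrt (norm A) *\<^sub>R X) = (sqrt (norm A) *\<^sub>R X) o\<^sub>L C"
      using X(3) by (simp add: blinfun_compose_simps)
  qed
qed

text \<open>\<open>Z\<close> commutes with its own square, hence with \<open>X\<close>, so
  \<open>X + Z\<close> kills \<open>w = X x - Z x\<close>. By positivity both \<open>X\<close> and
  \<open>Z\<close> kill \<open>w\<close>, and symmetry makes \<open>w\<close> orthogonal to itself.
  The hypothesis \<open>comm\<close> concerns \<open>X\<close> alone because a constructed root is
  compared with an arbitrary one.\<close>

lemma psd_op_sqrt_unique:
  fixes X :: "'a::{real_inner,banach} \<Rightarrow>\<^sub>L 'a"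
  assumes X: "psd_op X" and Z: "psd_op Z" and eq: "X o\<^sub>L X = Z o\<^sub>L Z"
    and comm: "\<And>C. C o\<^sub>L (X o\<^sub>L X) = (X o\<^sub>L X) o\<^sub>L C \<Longrightarrow> C o\<^sub>L X = X o\<^sub>L C"
  shows "X = Z"
proof (rule blinfun_eqI)
  fix x
  have "Z o\<^sub>L X = X o\<^sub>L Z" by (rule comm) (simp add: eq blinfun_compose_assoc)
  then have ZX: "Z (X v) = X (Z v)" for v by (metis blinfun_apply_blinfun_compose)
  have XX: "X (X v) = Z (Z v)" for v using eq by (metis blinfun_apply_blinfun_compose)
  define w where "w = X x - Z x"
  have "X w + Z w = 0"
    by (simp add: w_def blinfun.bilinear_simps ZX XX)
  then have "inner (X w) w + inner (Z w) w = 0" by (metis inner_add_left inner_zero_left)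
  then have "inner (X w) w = 0" "inner (Z w) w = 0"
    using psd_opD[OF X, of w] psd_opD[OF Z, of w] by linarith+
  then have "X w = 0" "Z w = 0" using psd_op_inner_eq_0D X Z by blast+
  then have "inner (X x) w = 0" "inner (Z x) w = 0"
    using sym_opD[OF psd_op_sym[OF X], of x w] sym_opD[OF psd_op_sym[OF Z], of x w] by simp_all
  then have "inner w w = 0"
    using inner_diff_left[of "X x" "Z x" w] by (simp add: w_def[symmetric])
  then show "X x = Z x" by (simp add: w_def)
qed

subsection \<open>Symmetric operators with closed range\<close>

lemma subspace_range_blinfun: "subspace (range (blinfun_apply A))"
  by (rule linear_subspace_image[OF _ subspace_UNIV])
    (simp add: blinfun.bounded_linear_right bounded_linear.linear)

lemma subspace_closure:
  fixes S :: "'a::real_normed_vector set"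
  assumes S: "subspace S"
  shows "subspace (closure S)"
  unfolding subspace_def
proof (intro conjI ballI allI)
  show "0 \<in> closure S" using subspace_0[OF S] closure_subset by blast
next
  fix x y assume "x \<in> closure S" "y \<in> closure S"
  then obtain f g where "\<forall>n. f n \<in> S" "f \<longlonglongrightarrow> x" "\<forall>n. g n \<in> S" "g \<longlonglongrightarrow> y"
    unfolding closure_sequential by blast
  then show "x + y \<in> closure S"
    unfolding closure_sequential
    by (intro exI[of _ "\<lambda>n. f n + g n"]) (auto intro: tendsto_add subspace_add[OF S])
next
  fix c :: real and x assume "x \<in> closure S"
  then obtain f where "\<forall>n. f n \<in> S" "f \<longlonglongrightarrow> x"
    unfolding closure_sequential by blast
  then show "c *\<^sub>R x \<in> closure S"
    unfolding closure_sequential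
    by (intro exI[of _ "\<lambda>n. c *\<^sub>R f n"]) (auto intro: tendsto_scaleR subspace_scale[OF S])
qed

lemma subspace_closure_range_blinfun: "subspace (closure (range (blinfun_apply A)))"
  by (rule subspace_closure[OF subspace_range_blinfun])

lemma sym_op_null_iff:
  assumes A: "sym_op A"
  shows "A v = 0 \<longleftrightarrow> (\<forall>y\<in>range A. inner y v = 0)"
proof
  assume "\<forall>y\<in>range A. inner y v = 0"
  then have "inner (A (A v)) v = 0" by blast
  then show "A v = 0" using sym_opD[OF A, of "A v" v] by simp
qed (auto simp: sym_opD[OF A])

lemma sym_op_range_decomposition:
  fixes A :: "'a::{real_inner,banach} \<Rightarrow>\<^sub>L 'a"
  assumes A: "sym_op A" and cl: "closed (range A)"
  obtains w v where "x = A w + v" "A v = 0"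
proof -
  obtain u where u: "u \<in> range A" "\<And>v. v \<in> range A \<Longrightarrow> inner (x - u) v = 0"
    using orthogonal_decomposition[OF subspace_range_blinfun cl, of x] by blast
  then obtain w where "u = A w" by blast
  moreover have "A (x - u) = 0"
    unfolding sym_op_null_iff[OF A] using u(2) by (simp add: inner_commute)
  ultimately show ?thesis by (intro that[of w "x - u"]) simp_all
qed

text \<open>A closed range is the orthogonal complement of the null space; this turns equality of
  null spaces into equality of ranges.\<close>

lemma sym_op_range_iff:
  fixes A :: "'a::{real_inner,banach} \<Rightarrow>\<^sub>L 'a"
  assumes A: "sym_op A" and cl: "closed (range A)"
  shows "y \<in> range A \<longleftrightarrow> (\<forall>v. A v = 0 \<longrightarrow> inner y v = 0)"
proof
  assume *: "\<forall>v. A v = 0 \<longrightarrow> inner y v = 0"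
  obtain w v where wv: "y = A w + v" "A v = 0"
    by (rule sym_op_range_decomposition[OF A cl])
  have "inner (A w) v = 0" using wv(2) by (simp add: sym_opD[OF A])
  moreover have "inner y v = 0" using * wv(2) by blast
  ultimately have "v = 0" using wv(1) by (simp add: inner_add_left)
  then show "y \<in> range A" using wv(1) by simp
qed (auto simp: sym_opD[OF A])

lemma sym_op_square_null:
  assumes A: "sym_op A"
  shows "A (A x) = 0 \<longleftrightarrow> A x = 0"
  using sym_opD[OF A, of "A x" x] by (auto simp: blinfun.zero_right)

text \<open>If \<open>x = A w + v\<close> with \<open>A v = 0\<close>, then \<open>A x\<close> is
  the value of the square at \<open>w\<close>. Closedness of either range yields such a splitting,
  since \<open>A\<close> and its square have the same null space. The disjunction lets closedness
  pass between an operator and its root in both directions.\<close>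

lemma sym_op_range_square:
  fixes A :: "'a::{real_inner,banach} \<Rightarrow>\<^sub>L 'a"
  assumes A: "sym_op A" and cl: "closed (range A) \<or> closed (range (A o\<^sub>L A))"
  shows "range (A o\<^sub>L A) = range A"
proof
  show "range (A o\<^sub>L A) \<subseteq> range A" by auto
  have sq: "sym_op (A o\<^sub>L A)" using A by (simp add: sym_op_def)
  show "range A \<subseteq> range (A o\<^sub>L A)"
  proof
    fix y assume "y \<in> range A"
    then obtain x where y: "y = A x" by blast
    from cl have "\<exists>w v. x = A w + v \<and> A v = 0"
    proof
      assume "closed (range A)"
      from sym_op_range_decomposition[OF A this, of x] show ?thesis by blast
    next
      assume "closed (range (A o\<^sub>L A))"
      from sym_op_range_decomposition[OF sq this, of x]
      obtain w v where "x = A (A w) + v" "A v = 0" by (auto simp: sym_op_square_null[OF A])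
      then show ?thesis by blast
    qed
    then obtain w v where "x = A w + v" "A v = 0" by blast
    then have "y = (A o\<^sub>L A) w" by (simp add: y blinfun.add_right)
    then show "y \<in> range (A o\<^sub>L A)" by blast
  qed
qed

text \<open>The vectors \<open>z\<close> of the range with \<open>\<parallel>A z\<parallel> \<le> 1\<close> are weakly bounded, since they pair with
  \<open>A w + v\<close>, \<open>A v = 0\<close>, to at most \<open>\<parallel>w\<parallel>\<close>.\<close>

lemma sym_op_bounded_below:
  fixes A :: "'a::{real_inner,banach} \<Rightarrow>\<^sub>L 'a"
  assumes A: "sym_op A" and cl: "closed (range A)"
  obtains K where "K \<ge> 0" "\<And>u. u \<in> range A \<Longrightarrow> norm u \<le> K * norm (A u)"
proof -
  define Z where "Z = {z \<in> range A. norm (A z) \<le> 1}"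
  have "\<exists>M. \<forall>z\<in>Z. \<bar>inner z y\<bar> \<le> M" for y
  proof -
    obtain w v where wv: "y = A w + v" "A v = 0"
      by (rule sym_op_range_decomposition[OF A cl])
    have "\<bar>inner z y\<bar> \<le> norm w" if z: "z \<in> Z" for z
    proof -
      have "inner z v = 0" using z wv(2) sym_op_null_iff[OF A] by (auto simp: Z_def)
      then have "inner z y = inner (A z) w"
        by (simp add: wv(1) inner_add_right sym_opD[OF A])
      also have "\<bar>\<dots>\<bar> \<le> norm (A z) * norm w" by (rule Cauchy_Schwarz_ineq2)
      also have "\<dots> \<le> 1 * norm w" using z by (intro mult_right_mono) (auto simp: Z_def)
      finally show ?thesis by simp
    qed
    then show ?thesis by blast
  qed
  then obtain K where K: "\<And>z. z \<in> Z \<Longrightarrow> norm z \<le> K"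
    using weakly_bounded_imp_bounded[of Z] by blast
  have "norm u \<le> max K 0 * norm (A u)" if u: "u \<in> range A" for u
  proof (cases "A u = 0")
    case True
    then have "inner u u = 0" using u sym_op_null_iff[OF A] by blast
    then show ?thesis by simp
  next
    case False
    have "(1 / norm (A u)) *\<^sub>R u \<in> Z"
      using u False subspace_scale[OF subspace_range_blinfun[of A] u]
      by (simp add: Z_def blinfun.scaleR_right)
    from K[OF this] have "norm u \<le> K * norm (A u)"
      using False by (simp add: field_simps)
    also have "\<dots> \<le> max K 0 * norm (A u)" by (intro mult_right_mono) auto
    finally show ?thesis .
  qed
  then show ?thesis by (intro that[of "max K 0"]) auto
qed

lemma psd_op_dominated:
  fixes A B :: "'a::{real_inner,banach} \<Rightarrow>\<^sub>L 'a"
  assumes A: "psd_op A" and B: "psd_op B" and cl: "closed (range B)"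
    and null: "\<And>v. B v = 0 \<Longrightarrow> A v = 0"
  obtains l where "l > 0" "\<And>x. inner (A x) x \<le> l * inner (B x) x"
proof -
  obtain K where K: "K \<ge> 0" "\<And>u. u \<in> range B \<Longrightarrow> norm u \<le> K * norm (B u)"
    using sym_op_bounded_below[OF psd_op_sym[OF B] cl] by blast
  \<comment> \<open>The factors arise in turn from bounding the form of \<open>A\<close> by its
    norm, from the lower bound of \<open>B\<close> on its range, and from
    \<open>psd_op_norm_power2_le\<close>. The summand 1 makes the constant strictly
    positive.\<close>
  let ?l = "norm A * (K\<^sup>2 * norm B) + 1"
  have "inner (A x) x \<le> ?l * inner (B x) x" for x
  proof -
    obtain w v where wv: "x = B w + v" "B v = 0"
      by (rule sym_op_range_decomposition[OF psd_op_sym[OF B] cl])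
    have Av: "A v = 0" using null wv(2) by blast
    have "inner (A x) x = inner (A (B w)) (B w)"
      using Av sym_opD[OF psd_op_sym[OF A], of "B w" v]
      by (simp add: wv(1) blinfun.add_right inner_add_right)
    also have "\<dots> \<le> norm (A (B w)) * norm (B w)" by (rule norm_cauchy_schwarz)
    also have "\<dots> \<le> norm A * norm (B w) * norm (B w)"
      by (intro mult_right_mono norm_blinfun norm_ge_zero)
    also have "\<dots> = norm A * (norm (B w))\<^sup>2" by (simp add: power2_eq_square)
    also have "\<dots> \<le> norm A * (K\<^sup>2 * (norm (B x))\<^sup>2)"
    proof (intro mult_left_mono norm_ge_zero)
      have "norm (B w) \<le> K * norm (B x)"
        using K(2)[of "B w"] wv by (simp add: blinfun.add_right)
      then show "(norm (B w))\<^sup>2 \<le> K\<^sup>2 * (norm (B x))\<^sup>2"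
        using power_mono[of "norm (B w)" "K * norm (B x)" 2] by (simp add: power_mult_distrib)
    qed
    also have "\<dots> \<le> norm A * (K\<^sup>2 * (norm B * inner (B x) x))"
      by (intro mult_left_mono psd_op_norm_power2_le[OF B] norm_ge_zero zero_le_power2)
    also have "\<dots> \<le> ?l * inner (B x) x"
      using psd_opD[OF B, of x] by (simp add: algebra_simps)
    finally show ?thesis .
  qed
  moreover have "?l > 0" using K(1) by (intro add_nonneg_pos mult_nonneg_nonneg) auto
  ultimately show ?thesis using that by blast
qed

subsection \<open>Differences of mutually annihilating operators\<close>

text \<open>On the range of \<open>Q\<close> the form of \<open>Q + R\<close> is that of
  \<open>Q\<close>, so the latter is nonnegative there and, by continuity, on the closure. The part
  of \<open>x\<close> orthogonal to the closure is a null vector of \<open>Q\<close> and contributes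
  nothing. Closures are taken because the range may fail to be closed.\<close>

lemma psd_op_summand:
  fixes Q R :: "'a::{real_inner,banach} \<Rightarrow>\<^sub>L 'a"
  assumes Q: "sym_op Q" and RQ: "\<And>x. R (Q x) = 0" and QR: "psd_op (Q + R)"
  shows "psd_op Q"
  unfolding psd_op_def
proof (intro conjI allI)
  fix x
  have "range Q \<subseteq> {u. 0 \<le> inner (Q u) u}"
  proof
    fix u assume "u \<in> range Q"
    then obtain w where "u = Q w" by blast
    then show "u \<in> {u. 0 \<le> inner (Q u) u}"
      using psd_opD[OF QR, of u] RQ by (simp add: blinfun.add_left)
  qed
  moreover have "closed {u. 0 \<le> inner (Q u) u}"
    by (intro closed_Collect_le continuous_intros)
  ultimately have clo: "closure (range Q) \<subseteq> {u. 0 \<le> inner (Q u) u}"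
    by (rule closure_minimal)
  obtain u where u: "u \<in> closure (range Q)" "\<And>v. v \<in> closure (range Q) \<Longrightarrow> inner (x - u) v = 0"
    using orthogonal_decomposition[OF subspace_closure_range_blinfun closed_closure, where x = x]
    by blast
  have "Q (x - u) = 0"
    unfolding sym_op_null_iff[OF Q] using u(2) closure_subset[of "range Q"]
    by (auto simp: inner_commute)
  then have eq: "Q x = Q u" by (simp add: blinfun.diff_right)
  have "inner (Q x) x = inner (Q u) u"
    using sym_opD[OF Q, of u x] eq by (simp add: inner_commute)
  then show "0 \<le> inner (Q x) x" using clo u(1) by auto
qed (rule Q)

lemma closed_range_summand:
  fixes P N :: "'a::{real_inner,banach} \<Rightarrow>\<^sub>L 'a"
  assumes P: "sym_op P" and N: "sym_op N"
    and PN: "\<And>x. P (N x) = 0" and NP: "\<And>x. N (P x) = 0"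
    and cl: "closed (range (P - N))"
  shows "closed (range P)"
proof -
  have S: "sym_op (P - N)"
    using P N by (simp add: sym_op_def blinfun.diff_left inner_diff_left inner_diff_right)
  \<comment> \<open>The range of \<open>P\<close> is cut out of a closed set by the closed condition
    \<open>N y = 0\<close>.\<close>
  have "range P = range (P - N) \<inter> {y. N y = 0}"
  proof (intro subset_antisym subsetI)
    fix y assume "y \<in> range P"
    then obtain x where y: "y = P x" by blast
    obtain w v where wv: "x = (P - N) w + v" "(P - N) v = 0"
      by (rule sym_op_range_decomposition[OF S cl])
    have "P v = N v" using wv(2) by (simp add: blinfun.diff_left)
    then have "P (P v) = 0" using PN by simp
    then have "P v = 0" by (simp add: sym_op_square_null[OF P])
    then have "y = (P - N) (P w)" "N y = 0"
      by (simp_all add: y wv(1) blinfun.diff_left blinfun.diff_right blinfun.add_right PN NP)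
    then show "y \<in> range (P - N) \<inter> {y. N y = 0}" by blast
  next
    fix y assume "y \<in> range (P - N) \<inter> {y. N y = 0}"
    then obtain w where w: "y = (P - N) w" and "N y = 0" by blast
    then have "N (N w) = 0" by (simp add: blinfun.diff_left blinfun.diff_right NP)
    then have "N w = 0" by (simp add: sym_op_square_null[OF N])
    then show "y \<in> range P" using w by (simp add: blinfun.diff_left)
  qed
  moreover have "closed {y. N y = 0}"
    by (intro closed_Collect_eq continuous_intros)
  ultimately show ?thesis using cl by (simp add: closed_Int)
qed

lemma closed_range_diff:
  fixes P N :: "'a::{real_inner,banach} \<Rightarrow>\<^sub>L 'a"
  assumes P: "sym_op P" and N: "sym_op N"
    and PN: "\<And>x. P (N x) = 0" and NP: "\<And>x. N (P x) = 0"
    and clP: "closed (range P)" and clN: "closed (range N)"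
  shows "closed (range (P - N))"
proof -
  \<comment> \<open>The range is the orthogonal complement of the common null space of
    \<open>P\<close> and \<open>N\<close>, an intersection of closed hyperplanes.\<close>
  have "range (P - N) = (\<Inter>v\<in>{v. P v = 0 \<and> N v = 0}. {y. inner y v = 0})"
  proof (intro subset_antisym subsetI)
    fix y assume "y \<in> range (P - N)"
    then show "y \<in> (\<Inter>v\<in>{v. P v = 0 \<and> N v = 0}. {y. inner y v = 0})"
      by (auto simp: blinfun.diff_left inner_diff_left sym_opD[OF P] sym_opD[OF N])
  next
    fix y assume y: "y \<in> (\<Inter>v\<in>{v. P v = 0 \<and> N v = 0}. {y. inner y v = 0})"
    obtain p b where p: "y = P p + b" "P b = 0"
      by (rule sym_op_range_decomposition[OF P clP])
    obtain q d where q: "b = N q + d" "N d = 0"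
      by (rule sym_op_range_decomposition[OF N clN])
    have Pd: "P d = 0" using p(2) by (simp add: q(1) blinfun.add_right PN)
    have "inner y d = 0" using y Pd q(2) by simp
    then have "inner d d = 0"
      using Pd q(2) by (simp add: p(1) q(1) inner_add_left sym_opD[OF P] sym_opD[OF N])
    then have y': "y = P p + N q" using p q by simp
    obtain p' p0 where "p = P p' + p0" "P p0 = 0"
      by (rule sym_op_range_decomposition[OF P clP])
    moreover obtain q' q0 where "q = N q' + q0" "N q0 = 0"
      by (rule sym_op_range_decomposition[OF N clN])
    \<comment> \<open>The sign of \<open>N q'\<close> compensates the one in \<open>P - N\<close>,
      and the mixed terms vanish, leaving \<open>P (P p') + N (N q')\<close>.\<close>
    ultimately have "y = (P - N) (P p' - N q')"
      by (simp add: y' blinfun.diff_left blinfun.diff_right blinfun.add_right PN NP)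
    then show "y \<in> range (P - N)" by blast
  qed
  moreover have "closed \<dots>"
    by (intro closed_INT ballI closed_Collect_eq continuous_intros)
  ultimately show ?thesis by simp
qed

subsection \<open>Complex-linear operators\<close>

instance complex_hilbert \<subseteq> banach ..

lemma norm_scaleC: "norm (c *\<^sub>C x) = cmod c * norm x"
  for x :: "'a::complex_inner"
proof -
  have "complex_of_real ((norm (c *\<^sub>C x))\<^sup>2) = cinner (c *\<^sub>C x) (c *\<^sub>C x)"
    by (rule cinner_self[symmetric])
  also have "\<dots> = c * cnj c * cinner x x"
    using cinner_commute[of x "c *\<^sub>C x"] by (simp add: cinner_scaleC_left flip: cinner_commute)
  also have "\<dots> = complex_of_real ((cmod c * norm x)\<^sup>2)"
    by (simp add: cinner_self power_mult_distrib complex_norm_square[symmetric])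
  finally have "(norm (c *\<^sub>C x))\<^sup>2 = (cmod c * norm x)\<^sup>2"
    by (simp only: of_real_eq_iff)
  then show ?thesis by (simp add: power2_eq_iff_nonneg)
qed

lemma bounded_linear_scaleC: "bounded_linear (\<lambda>x::'a::complex_inner. c *\<^sub>C x)"
proof
  fix r and x :: 'a
  show "c *\<^sub>C (r *\<^sub>R x) = r *\<^sub>R (c *\<^sub>C x)"
    by (simp flip: scaleC_complex_of_real add: scaleC_scaleC mult.commute)
  show "\<exists>K. \<forall>x::'a. norm (c *\<^sub>C x) \<le> norm x * K"
    by (rule exI[of _ "cmod c"]) (simp add: norm_scaleC)
qed (rule scaleC_add_right)

definition scaleC_op :: "complex \<Rightarrow> 'a::complex_inner \<Rightarrow>\<^sub>L 'a" where
  "scaleC_op c = Blinfun (\<lambda>x. c *\<^sub>C x)"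

lemma scaleC_op_apply [simp]: "scaleC_op c x = c *\<^sub>C x"
  by (simp add: scaleC_op_def bounded_linear_Blinfun_apply bounded_linear_scaleC)

lemma scaleC_diff_right: "c *\<^sub>C (x - y) = c *\<^sub>C x - c *\<^sub>C y"
  using blinfun.diff_right[of "scaleC_op c" x y] by simp

lemma scaleC_scaleR: "c *\<^sub>C r *\<^sub>R x = r *\<^sub>R c *\<^sub>C x"
  using blinfun.scaleR_right[of "scaleC_op c" r x] by simp

lemma Re_cinner: "Re (cinner x y) = inner x y"
  by (simp add: inner_eq_Re_cinner)

text \<open>Together with \<open>Re_cinner\<close> this expresses the complex inner product through
  the real one, so real identities that remain valid after multiplying a vector by the imaginary
  unit become complex ones.\<close>

lemma Im_cinner: "Im (cinner x y) = inner x (\<i> *\<^sub>C y)"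
  by (metis Re_cinner cinner_commute cinner_scaleC_left complex_cnj_cnj complex_cnj_i
      complex_cnj_mult minus_mult_left Re_i_times minus_minus uminus_complex.sel(1))

text \<open>Complex-linearity as membership in a commutant, which is how square roots inherit it.\<close>

lemma bounded_ops_iff: "A \<in> bounded_ops \<longleftrightarrow> (\<forall>c. scaleC_op c o\<^sub>L A = A o\<^sub>L scaleC_op c)"
proof
  assume A: "\<forall>c. scaleC_op c o\<^sub>L A = A o\<^sub>L scaleC_op c"
  have "c *\<^sub>C A x = A (c *\<^sub>C x)" for c x
    using arg_cong[OF A[rule_format, of c], of "\<lambda>B. blinfun_apply B x"] by simp
  then show "A \<in> bounded_ops" by (simp add: bounded_ops_def)
qed (auto simp: bounded_ops_def intro: blinfun_eqI)

lemma bounded_opsD: "A \<in> bounded_ops \<Longrightarrow> A (c *\<^sub>C x) = c *\<^sub>C A x"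
  by (simp add: bounded_ops_def)

lemma bounded_ops_closed:
  assumes "A \<in> bounded_ops" "B \<in> bounded_ops"
  shows "A + B \<in> bounded_ops" "A - B \<in> bounded_ops" "A o\<^sub>L B \<in> bounded_ops"
  using assms
  by (simp_all add: bounded_ops_def blinfun.bilinear_simps scaleC_add_right scaleC_diff_right)

lemma bounded_ops_scaleR: "A \<in> bounded_ops \<Longrightarrow> r *\<^sub>R A \<in> bounded_ops"
  by (simp add: bounded_ops_def blinfun.scaleR_left scaleC_scaleR)

lemma selfadj_ops_iff: "A \<in> selfadj_ops \<longleftrightarrow> A \<in> bounded_ops \<and> sym_op A"
proof (intro iffI conjI)
  assume A: "A \<in> selfadj_ops"
  then show "A \<in> bounded_ops" by (simp add: selfadj_ops_def)
  show "sym_op A" using A by (simp add: selfadj_ops_def sym_op_def inner_eq_Re_cinner)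
next
  assume A: "A \<in> bounded_ops \<and> sym_op A"
  show "A \<in> selfadj_ops"
    unfolding selfadj_ops_def
  proof (intro CollectI conjI allI)
    fix x y
    show "cinner (A x) y = cinner x (A y)"
      using A by (intro complex_eqI) (simp_all add: Re_cinner Im_cinner sym_opD bounded_opsD
        flip: bounded_opsD)
  qed (use A in simp)
qed

lemma loewner_le_iff: "A \<preceq> B \<longleftrightarrow> (\<forall>x. inner (A x) x \<le> inner (B x) x)"
  by (simp add: loewner_le_def Re_cinner)

lemma pos_ops_iff: "A \<in> pos_ops \<longleftrightarrow> A \<in> bounded_ops \<and> psd_op A"
  by (auto simp: pos_ops_def selfadj_ops_iff psd_op_def loewner_le_iff)

lemma op_adj_selfadj:
  assumes A: "A \<in> selfadj_ops"
  shows "op_adj A = A"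
  unfolding op_adj_def
proof (rule the_equality)
  show "A \<in> bounded_ops \<and> (\<forall>x y. cinner (A x) y = cinner x (A y))"
    using A by (simp add: selfadj_ops_def)
  fix B assume B: "B \<in> bounded_ops \<and> (\<forall>x y. cinner (A x) y = cinner x (B y))"
  show "B = A"
  proof (rule blinfun_eqI)
    fix y
    have "inner x (B y) = inner x (A y)" for x
    proof -
      have "cinner (A x) y = cinner x (B y)" using B by blast
      moreover have "cinner (A x) y = cinner x (A y)" using A by (simp add: selfadj_ops_def)
      ultimately show ?thesis by (metis Re_cinner)
    qed
    then show "B y = A y" using vector_eq_ldot by blast
  qed
qed

subsection \<open>Square root, absolute value and the two parts\<close>

text \<open>The constructed root, which has the commutation property, coincides with every positive
  root; so \<open>X\<close> inherits the property.\<close>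

lemma op_sqrt_eqI:
  assumes X: "X \<in> pos_ops" and XX: "X o\<^sub>L X = A"
  shows "op_sqrt A = X"
    and "C o\<^sub>L A = A o\<^sub>L C \<Longrightarrow> C o\<^sub>L X = X o\<^sub>L C"
proof -
  have pX: "psd_op X" using X by (simp add: pos_ops_iff)
  have "psd_op A" using psd_op_square[OF psd_op_sym[OF pX]] XX by simp
  then obtain Y where Y: "psd_op Y" "Y o\<^sub>L Y = A" "\<And>C. C o\<^sub>L A = A o\<^sub>L C \<Longrightarrow> C o\<^sub>L Y = Y o\<^sub>L C"
    using psd_op_sqrt_exists by blast
  have uniq: "Y = Z" if "psd_op Z" "Z o\<^sub>L Z = A" for Z
  proof (rule psd_op_sqrt_unique[OF Y(1) that(1)])
    show "Y o\<^sub>L Y = Z o\<^sub>L Z" using Y(2) that(2) by simp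
  qed (rule Y(3), simp only: Y(2))
  show "C o\<^sub>L X = X o\<^sub>L C" if "C o\<^sub>L A = A o\<^sub>L C"
    using Y(3)[OF that] uniq[OF pX XX] by simp
  show "op_sqrt A = X"
    unfolding op_sqrt_def
    by (rule the_equality) (use X XX uniq pX in \<open>auto simp: pos_ops_iff\<close>)
qed

lemma op_sqrt:
  assumes A: "A \<in> pos_ops"
  shows "op_sqrt A \<in> pos_ops" "op_sqrt A o\<^sub>L op_sqrt A = A"
proof -
  have bA: "A \<in> bounded_ops" and pA: "psd_op A" using A by (simp_all add: pos_ops_iff)
  obtain Y where Y: "psd_op Y" "Y o\<^sub>L Y = A" "\<And>C. C o\<^sub>L A = A o\<^sub>L C \<Longrightarrow> C o\<^sub>L Y = Y o\<^sub>L C"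
    using psd_op_sqrt_exists[OF pA] by blast
  have "Y \<in> pos_ops" using Y(1,3) bA by (simp add: pos_ops_iff bounded_ops_iff)
  then show "op_sqrt A \<in> pos_ops" "op_sqrt A o\<^sub>L op_sqrt A = A"
    using op_sqrt_eqI(1)[OF _ Y(2)] Y(2) by simp_all
qed

lemma range_op_sqrt:
  assumes A: "A \<in> pos_ops" and cl: "closed (range A) \<or> closed (range (op_sqrt A))"
  shows "range (op_sqrt A) = range A"
  using sym_op_range_square[of "op_sqrt A"] op_sqrt[OF A] cl
  by (simp add: pos_ops_iff psd_op_sym disj_commute)

lemma op_abs:
  assumes T: "T \<in> selfadj_ops"
  shows "op_abs T \<in> pos_ops" "op_abs T o\<^sub>L op_abs T = T o\<^sub>L T" "T o\<^sub>L op_abs T = op_abs T o\<^sub>L T"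
proof -
  have TT: "T o\<^sub>L T \<in> pos_ops"
    using T by (simp add: pos_ops_iff selfadj_ops_iff psd_op_square bounded_ops_closed(3))
  have eq: "op_abs T = op_sqrt (T o\<^sub>L T)" by (simp add: op_abs_def op_adj_selfadj[OF T])
  show "op_abs T \<in> pos_ops" "op_abs T o\<^sub>L op_abs T = T o\<^sub>L T"
    using op_sqrt[OF TT] by (simp_all add: eq)
  then show "T o\<^sub>L op_abs T = op_abs T o\<^sub>L T"
    by (rule op_sqrt_eqI(2)) (simp add: blinfun_compose_assoc)
qed

lemma op_abs_pos:
  assumes S: "S \<in> pos_ops"
  shows "op_abs S = S"
  using S op_sqrt_eqI(1)[OF S refl]
  by (simp add: op_abs_def op_adj_selfadj pos_ops_def)

lemma op_pos_minus_op_neg: "op_pos T - op_neg T = T"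
  and op_pos_plus_op_neg: "op_pos T + op_neg T = op_abs T"
  unfolding op_pos_def op_neg_def scaleR_diff_right[symmetric] scaleR_add_right[symmetric]
  by simp_all

text \<open>Up to the factor 1/4 the product is \<open>(op_abs T + T) (op_abs T - T)\<close>, a
  difference of equal squares because \<open>T\<close> commutes with
  \<open>op_abs T\<close>.\<close>

lemma op_pos_neg_compose:
  assumes T: "T \<in> selfadj_ops"
  shows "op_pos T (op_neg T x) = 0" "op_neg T (op_pos T x) = 0"
proof -
  have "op_abs T (op_abs T v) = T (T v)" "T (op_abs T v) = op_abs T (T v)" for v
    using op_abs(2,3)[OF T, THEN arg_cong, of "\<lambda>B. blinfun_apply B v"] by simp_all
  then show "op_pos T (op_neg T x) = 0" "op_neg T (op_pos T x) = 0"
    by (simp_all add: op_pos_def op_neg_def blinfun.bilinear_simps algebra_simps)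
qed

lemma op_pos_neg_in_pos_ops:
  assumes T: "T \<in> selfadj_ops"
  shows "op_pos T \<in> pos_ops" "op_neg T \<in> pos_ops"
proof -
  have b: "op_pos T \<in> bounded_ops" "op_neg T \<in> bounded_ops"
    and M: "psd_op (op_abs T)" and s: "sym_op (op_pos T)" "sym_op (op_neg T)"
    using T op_abs(1)[OF T]
    by (auto simp: op_pos_def op_neg_def pos_ops_iff selfadj_ops_iff bounded_ops_closed
        bounded_ops_scaleR psd_op_def sym_op_def blinfun.bilinear_simps inner_simps)
  have "psd_op (op_pos T)"
    by (rule psd_op_summand[where R = "op_neg T"])
      (use s M op_pos_neg_compose[OF T] op_pos_plus_op_neg[of T] in auto)
  moreover have "psd_op (op_neg T)"
    by (rule psd_op_summand[where R = "op_pos T"])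
      (use s M op_pos_neg_compose[OF T] op_pos_plus_op_neg[of T] in \<open>auto simp: add.commute\<close>)
  ultimately show "op_pos T \<in> pos_ops" "op_neg T \<in> pos_ops"
    using b by (simp_all add: pos_ops_iff)
qed

lemma sym_op_pos_neg:
  assumes T: "T \<in> selfadj_ops"
  shows "sym_op (op_pos T)" "sym_op (op_neg T)"
  using op_pos_neg_in_pos_ops[OF T] by (simp_all add: pos_ops_iff psd_op_sym)

text \<open>\<open>op_pos T x\<close> and \<open>op_neg T x\<close> are orthogonal, so their
  difference \<open>T x\<close> and their sum \<open>op_abs T x\<close> vanish only if both vectors
  do.\<close>

lemma null_op_pos_neg_iff:
  assumes T: "T \<in> selfadj_ops"
  shows "T x = 0 \<longleftrightarrow> op_pos T x = 0 \<and> op_neg T x = 0"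
    and "op_abs T x = 0 \<longleftrightarrow> T x = 0"
proof -
  have app: "T x = op_pos T x - op_neg T x" "op_abs T x = op_pos T x + op_neg T x"
    by (metis op_pos_minus_op_neg blinfun.diff_left, metis op_pos_plus_op_neg blinfun.add_left)
  have orth: "inner (op_pos T x) (op_neg T x) = 0"
    using sym_opD[OF sym_op_pos_neg(1)[OF T]] op_pos_neg_compose[OF T] by simp
  have "op_pos T x = 0 \<and> op_neg T x = 0" if "op_pos T x = op_neg T x \<or> op_pos T x = - op_neg T x"
    using that orth by auto
  then show "T x = 0 \<longleftrightarrow> op_pos T x = 0 \<and> op_neg T x = 0" "op_abs T x = 0 \<longleftrightarrow> T x = 0"
    by (auto simp: app add_eq_0_iff2)
qed

lemma closed_range_iff_op_pos_neg:
  assumes T: "T \<in> selfadj_ops"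
  shows "closed (range T) \<longleftrightarrow> closed (range (op_pos T)) \<and> closed (range (op_neg T))"
proof -
  note s = sym_op_pos_neg[OF T] and o = op_pos_neg_compose[OF T]
  \<comment> \<open>Passing to \<open>- T\<close> exchanges the two parts, so
    \<open>closed_range_summand\<close> also covers \<open>op_neg T\<close>.\<close>
  have "range (op_neg T - op_pos T) = range T"
  proof (intro subset_antisym subsetI)
    have neg: "(op_neg T - op_pos T) x = T (- x)" for x
      by (subst (3) op_pos_minus_op_neg[of T, symmetric]) (simp add: blinfun.bilinear_simps)
    fix y
    show "y \<in> range (op_neg T - op_pos T) \<Longrightarrow> y \<in> range T" using neg by auto
    assume "y \<in> range T"
    then obtain x where "y = T x" by blast
    then have "y = (op_neg T - op_pos T) (- x)" by (simp add: neg)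
    then show "y \<in> range (op_neg T - op_pos T)" by blast
  qed
  then show ?thesis
    using closed_range_summand[OF s(1) s(2) o] closed_range_summand[OF s(2) s(1) o(2) o(1)]
      closed_range_diff[OF s o] by (auto simp: op_pos_minus_op_neg)
qed

lemma range_op_abs:
  assumes T: "T \<in> selfadj_ops" and cl: "closed (range T)"
  shows "range (op_abs T) = range T"
proof -
  have s: "sym_op T" "sym_op (op_abs T)"
    using T op_abs(1)[OF T] by (simp_all add: selfadj_ops_iff pos_ops_iff psd_op_sym)
  have "range (T o\<^sub>L T) = range T" using sym_op_range_square[OF s(1)] cl by blast
  then show ?thesis using sym_op_range_square[OF s(2)] cl op_abs(2)[OF T] by simp
qed

subsection \<open>Orthogonal projections\<close>

definition closed_csubspace :: "'a::complex_hilbert set \<Rightarrow> bool" where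
  "closed_csubspace V \<longleftrightarrow> subspace V \<and> closed V \<and> (\<forall>c. \<forall>x\<in>V. c *\<^sub>C x \<in> V)"

lemma orthogonal_decomposition_unique:
  fixes u u' :: "'a::real_inner"
  assumes "subspace V" "u \<in> V" "u' \<in> V"
    "\<And>v. v \<in> V \<Longrightarrow> inner (x - u) v = 0" "\<And>v. v \<in> V \<Longrightarrow> inner (x - u') v = 0"
  shows "u = u'"
proof -
  have "u - u' \<in> V" using assms(1-3) by (rule subspace_diff)
  then have "inner (x - u') (u - u') - inner (x - u) (u - u') = 0" using assms(4,5) by simp
  then have "inner (u - u') (u - u') = 0" by (simp flip: inner_diff_left)
  then show ?thesis by simp
qed

lemma op_proj:
  fixes V :: "'a::complex_hilbert set"
  assumes V: "closed_csubspace V"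
  shows op_proj_bounded_ops: "op_proj V \<in> bounded_ops"
    and op_proj_in: "op_proj V x \<in> V"
    and op_proj_orthogonal: "v \<in> V \<Longrightarrow> inner (x - op_proj V x) v = 0"
proof -
  have sV: "subspace V" and cV: "closed V" and mV: "\<And>c x. x \<in> V \<Longrightarrow> c *\<^sub>C x \<in> V"
    using V by (auto simp: closed_csubspace_def)
  have "\<exists>u\<in>V. \<forall>v\<in>V. inner (x - u) v = 0" for x
    using orthogonal_decomposition[OF sV cV, where x = x] by metis
  then obtain p where p: "\<And>x. p x \<in> V" "\<And>x v. v \<in> V \<Longrightarrow> inner (x - p x) v = 0" by metis
  \<comment> \<open>The imaginary part is a real inner product with a complex multiple of
    \<open>v\<close>, which again lies in \<open>V\<close>.\<close>
  have orth: "cinner (x - p x) v = 0" if "v \<in> V" for x v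
    using p(2) that mV by (intro complex_eqI) (simp_all add: Re_cinner Im_cinner)
  have pI: "p x = u" if "u \<in> V" "\<And>v. v \<in> V \<Longrightarrow> inner (x - u) v = 0" for x u
    by (rule orthogonal_decomposition_unique[OF sV p(1) that(1) p(2) that(2)])
  have "bounded_linear p"
  proof (rule bounded_linear_intro)
    fix x y
    show "p (x + y) = p x + p y"
    proof (rule pI)
      fix v assume v: "v \<in> V"
      have "x + y - (p x + p y) = (x - p x) + (y - p y)" by simp
      then show "inner (x + y - (p x + p y)) v = 0"
        using p(2)[OF v] by (simp only: inner_add_left)
    qed (simp add: p(1) sV subspace_add)
    show "p (r *\<^sub>R x) = r *\<^sub>R p x" for r
    proof (rule pI)
      show "inner (r *\<^sub>R x - r *\<^sub>R p x) v = 0" if "v \<in> V" for v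
        unfolding scaleR_diff_right[symmetric] using p(2)[OF that] by simp
    qed (simp add: p(1) sV subspace_scale)
    have "norm (p x) * norm (p x) \<le> norm x * norm (p x)"
    proof -
      have "inner (p x) (p x) = inner x (p x)"
        using p(2)[OF p(1), of x] by (simp add: inner_diff_left)
      then show ?thesis
        using norm_cauchy_schwarz[of x "p x"] by (simp add: dot_square_norm power2_eq_square)
    qed
    then show "norm (p x) \<le> norm x * 1"
      by (cases "p x = 0") simp_all
  qed
  then have bp: "blinfun_apply (Blinfun p) = p" by (rule bounded_linear_Blinfun_apply)
  have bB: "Blinfun p \<in> bounded_ops"
    unfolding bounded_ops_def
  proof (intro CollectI allI)
    fix c x
    have "inner (c *\<^sub>C x - c *\<^sub>C p x) v = 0" if "v \<in> V" for v
      using orth[OF that, of x] by (simp add: inner_eq_Re_cinner cinner_scaleC_left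
        flip: scaleC_diff_right)
    then show "Blinfun p (c *\<^sub>C x) = c *\<^sub>C Blinfun p x"
      unfolding bp by (intro pI mV p(1))
  qed
  have eq: "op_proj V = Blinfun p"
    unfolding op_proj_def
  proof (rule the_equality)
    show "Blinfun p \<in> bounded_ops \<and>
        (\<forall>x. Blinfun p x \<in> V \<and> (\<forall>v\<in>V. cinner (x - Blinfun p x) v = 0))"
      using bB p(1) orth by (simp add: bp)
    fix P assume P: "P \<in> bounded_ops \<and> (\<forall>x. P x \<in> V \<and> (\<forall>v\<in>V. cinner (x - P x) v = 0))"
    show "P = Blinfun p"
    proof (rule blinfun_eqI)
      fix x
      have "p x = P x"
        by (rule pI) (use P in \<open>simp_all add: inner_eq_Re_cinner\<close>)
      then show "P x = Blinfun p x" by (simp add: bp)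
    qed
  qed
  show "op_proj V \<in> bounded_ops" "op_proj V x \<in> V"
      "v \<in> V \<Longrightarrow> inner (x - op_proj V x) v = 0"
    using bB p by (simp_all add: bp eq)
qed

lemma op_proj_eqI:
  assumes V: "closed_csubspace V" and u: "u \<in> V" "\<And>v. v \<in> V \<Longrightarrow> inner (x - u) v = 0"
  shows "op_proj V x = u"
  by (rule orthogonal_decomposition_unique[OF _ op_proj_in[OF V] u(1) op_proj_orthogonal[OF V] u(2)])
    (use V in \<open>simp_all add: closed_csubspace_def\<close>)

lemma op_proj_eq_self: "closed_csubspace V \<Longrightarrow> x \<in> V \<Longrightarrow> op_proj V x = x"
  by (rule op_proj_eqI) simp_all

lemma op_proj_eq_0:
  assumes "closed_csubspace V" "\<And>v. v \<in> V \<Longrightarrow> inner x v = 0"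
  shows "op_proj V x = 0"
  using assms by (intro op_proj_eqI) (simp_all add: closed_csubspace_def subspace_0)

lemma range_op_proj: "closed_csubspace V \<Longrightarrow> range (op_proj V) = V"
  using op_proj_in op_proj_eq_self by (metis image_subset_iff rangeI subsetI subset_antisym)

lemma closed_csubspace_range:
  assumes "A \<in> bounded_ops" "closed (range A)"
  shows "closed_csubspace (range A)"
  using assms subspace_range_blinfun[of A]
  by (auto simp: closed_csubspace_def simp flip: bounded_opsD)

lemma closed_csubspace_null_space:
  assumes "A \<in> bounded_ops"
  shows "closed_csubspace (null_space A)"
proof -
  have "closed (null_space A)"
    unfolding null_space_def by (intro closed_Collect_eq continuous_intros)
  moreover have "c *\<^sub>C x \<in> null_space A" if "x \<in> null_space A" for c x
    using that assms blinfun.zero_right[of "scaleC_op c"]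
    by (simp add: null_space_def bounded_opsD del: blinfun.zero_right)
  moreover have "subspace (null_space A)"
    by (simp add: null_space_def subspace_def blinfun.add_right blinfun.scaleR_right)
  ultimately show ?thesis by (simp add: closed_csubspace_def)
qed

lemma sym_op_apply_op_proj_range:
  assumes A: "A \<in> selfadj_ops" and cl: "closed (range A)"
  shows "A (op_proj (range A) x) = A x"
proof -
  have V: "closed_csubspace (range A)" and s: "sym_op A"
    using A cl by (simp_all add: closed_csubspace_range selfadj_ops_iff)
  have "A (x - op_proj (range A) x) = 0"
    unfolding sym_op_null_iff[OF s] using op_proj_orthogonal[OF V] by (simp add: inner_commute)
  then show ?thesis by (simp add: blinfun.diff_right)
qed

subsection \<open>Moore-Penrose inverse\<close>

text \<open>\<open>X x\<close> is the preimage under \<open>A\<close>, inside the range of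
  \<open>A\<close>, of the projection of \<open>x\<close>. The lower bound on the range makes this
  preimage unique, hence linear in \<open>x\<close>, and bounded.\<close>

lemma op_pinv_exists:
  assumes A: "A \<in> selfadj_ops" and cl: "closed (range A)"
  obtains X where "X \<in> bounded_ops" "\<And>x. X x \<in> range A"
    "\<And>x. A (X x) = op_proj (range A) x" "\<And>x. X (A x) = op_proj (range A) x"
proof -
  have bA: "A \<in> bounded_ops" and s: "sym_op A" using A by (simp_all add: selfadj_ops_iff)
  have V: "closed_csubspace (range A)" using bA cl by (rule closed_csubspace_range)
  let ?P = "op_proj (range A)"
  obtain K where K: "K \<ge> 0" "\<And>u. u \<in> range A \<Longrightarrow> norm u \<le> K * norm (A u)"
    using sym_op_bounded_below[OF s cl] by blast
  have "\<exists>u\<in>range A. A u = ?P x" for x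
  proof -
    obtain w where "?P x = A w" using op_proj_in[OF V, of x] by blast
    then have "A (?P w) = ?P x" using sym_op_apply_op_proj_range[OF A cl] by simp
    then show ?thesis using op_proj_in[OF V] by blast
  qed
  then obtain f where f: "\<And>x. f x \<in> range A" "\<And>x. A (f x) = ?P x" by metis
  have fI: "f x = u" if "u \<in> range A" "A u = ?P x" for x u
  proof -
    have "f x - u \<in> range A"
      by (rule subspace_diff[OF subspace_range_blinfun f(1) that(1)])
    from K(2)[OF this] show ?thesis by (simp add: blinfun.diff_right f(2) that(2))
  qed
  have "bounded_linear f"
  proof (rule bounded_linear_intro)
    fix x y
    show "f (x + y) = f x + f y"
      by (rule fI) (simp_all add: f(1) f(2) subspace_add[OF subspace_range_blinfun] blinfun.add_right)
    show "f (r *\<^sub>R x) = r *\<^sub>R f x" for r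
      by (rule fI) (simp_all add: f(1) f(2) subspace_scale[OF subspace_range_blinfun] blinfun.scaleR_right)
    have "norm (f x) \<le> K * norm (?P x)" using K(2)[OF f(1)] by (simp add: f(2))
    also have "\<dots> \<le> K * (norm ?P * norm x)" by (intro mult_left_mono norm_blinfun K(1))
    finally show "norm (f x) \<le> norm x * (K * norm ?P)" by (simp add: mult_ac)
  qed
  then have bf: "blinfun_apply (Blinfun f) = f" by (rule bounded_linear_Blinfun_apply)
  show ?thesis
  proof (rule that[of "Blinfun f"])
    have "f (c *\<^sub>C x) = c *\<^sub>C f x" for c x
    proof (rule fI)
      show "c *\<^sub>C f x \<in> range A" using V f(1) unfolding closed_csubspace_def by blast
      show "A (c *\<^sub>C f x) = ?P (c *\<^sub>C x)"
        by (simp add: bounded_opsD[OF bA] bounded_opsD[OF op_proj_bounded_ops[OF V]] f(2))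
    qed
    then show "Blinfun f \<in> bounded_ops" by (simp add: bounded_ops_def bf)
    show "Blinfun f x \<in> range A" "A (Blinfun f x) = ?P x" for x
      unfolding bf by (rule f)+
    have "f (A x) = ?P x" for x
      by (rule fI)
        (simp_all add: op_proj_in[OF V] sym_op_apply_op_proj_range[OF A cl] op_proj_eq_self[OF V])
    then show "Blinfun f (A x) = ?P x" for x by (simp add: bf)
  qed
qed

lemma op_pinv:
  assumes A: "A \<in> selfadj_ops" and cl: "closed (range A)"
  shows "op_pinv A \<in> selfadj_ops" "range (op_pinv A) = range A"
    "op_pinv A x = 0 \<longleftrightarrow> A x = 0" "A \<in> pos_ops \<Longrightarrow> op_pinv A \<in> pos_ops"
proof -
  have bA: "A \<in> bounded_ops" and s: "sym_op A" using A by (simp_all add: selfadj_ops_iff)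
  have V: "closed_csubspace (range A)" using bA cl by (rule closed_csubspace_range)
  let ?P = "op_proj (range A)"
  note AP = sym_op_apply_op_proj_range[OF A cl]
  obtain X where X: "X \<in> bounded_ops" "\<And>x. X x \<in> range A"
    "\<And>x. A (X x) = ?P x" "\<And>x. X (A x) = ?P x"
    using op_pinv_exists[OF A cl] by blast
  have PX: "?P (X x) = X x" for x by (rule op_proj_eq_self[OF V X(2)])
  have PA: "?P (A x) = A x" for x by (rule op_proj_eq_self[OF V]) simp
  have XP: "X (?P x) = X x" for x using X(3,4) PX by metis
  have eq: "op_pinv A = X"
    unfolding op_pinv_def op_adj_selfadj[OF A]
  proof (rule the_equality)
    show "X \<in> bounded_ops \<and> A o\<^sub>L X o\<^sub>L A = A \<and> X o\<^sub>L A o\<^sub>L X = X \<and> A o\<^sub>L X = ?P \<and> X o\<^sub>L A = ?P"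
      by (intro conjI blinfun_eqI) (simp_all add: X(1) X(3,4) PX PA AP XP)
    fix Y assume Y: "Y \<in> bounded_ops \<and> A o\<^sub>L Y o\<^sub>L A = A \<and> Y o\<^sub>L A o\<^sub>L Y = Y \<and> A o\<^sub>L Y = ?P
      \<and> Y o\<^sub>L A = ?P"
    show "Y = X"
    proof (rule blinfun_eqI)
      fix x
      have "Y x = ?P (Y x)" using Y by (metis blinfun_apply_blinfun_compose)
      also have "\<dots> = X (A (Y x))" by (simp add: X(4))
      also have "A (Y x) = ?P x" using Y by (metis blinfun_apply_blinfun_compose)
      finally show "Y x = X x" by (simp add: XP)
    qed
  qed
  \<comment> \<open>As \<open>X x\<close> lies in the range, \<open>y\<close> may be replaced by its
    projection \<open>A (X y)\<close>. Symmetry and positivity of \<open>X\<close> are thereby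
    inherited from \<open>A\<close>.\<close>
  have inn: "inner (X x) y = inner (X x) (A (X y))" for x y
    using op_proj_orthogonal[OF V X(2), of y x]
    by (simp add: X(3) inner_diff_left inner_commute[of "X x"])
  have symX: "sym_op X"
    unfolding sym_op_def
  proof (intro allI)
    fix x y
    have "inner (X x) y = inner (X x) (A (X y))" by (rule inn)
    also have "\<dots> = inner (A (X x)) (X y)" by (rule sym_opD[OF s, symmetric])
    also have "\<dots> = inner (X y) (A (X x))" by (rule inner_commute)
    also have "\<dots> = inner (X y) x" by (rule inn[symmetric])
    finally show "inner (X x) y = inner x (X y)" by (simp only: inner_commute)
  qed
  show "op_pinv A \<in> selfadj_ops" using X(1) symX by (simp add: eq selfadj_ops_iff)
  have "A x = X (A (A x))" for x by (simp add: X(4) PA)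
  then have "range A \<subseteq> range X" by blast
  then show "range (op_pinv A) = range A" using X(2) by (auto simp: eq)
  show "op_pinv A x = 0 \<longleftrightarrow> A x = 0"
    using AP[of x] XP[of x] X(3,4)[of x] by (metis eq blinfun.zero_right)
  assume "A \<in> pos_ops"
  then have "psd_op A" by (simp add: pos_ops_iff)
  then have "0 \<le> inner (X x) x" for x
    using inn[of x x] psd_opD[of A "X x"] by (simp only: inner_commute)
  then show "op_pinv A \<in> pos_ops" using X(1) symX by (simp add: eq pos_ops_iff psd_op_def)
qed

lemma loewner_le_scaleR_exists:
  assumes "A \<in> pos_ops" "B \<in> pos_ops" "closed (range B)" "\<And>v. B v = 0 \<Longrightarrow> A v = 0"
  obtains l where "l > 0" "A \<preceq> l *\<^sub>R B"
proof -
  obtain l where "l > 0" "\<And>x. inner (A x) x \<le> l * inner (B x) x"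
    using psd_op_dominated[of A B] assms by (metis pos_ops_iff)
  then show ?thesis using that[of l] by (simp add: loewner_le_iff blinfun.scaleR_left)
qed

subsection \<open>Polar decomposition and reflection\<close>

text \<open>Two candidates agree on the range of \<open>op_abs T\<close> by the factorisation, on
  its closure by continuity, and vanish on the orthogonal complement, which is the null space of
  \<open>T\<close>.\<close>

lemma polar_factor_eqI:
  assumes T: "T \<in> selfadj_ops" and V: "partial_isometry V" "T = V o\<^sub>L op_abs T"
    "range V = closure (range T)" "null_space V = null_space T"
  shows "polar_factor T = V"
  unfolding polar_factor_def
proof (rule the_equality)
  show "partial_isometry V \<and> T = V o\<^sub>L op_abs T \<and> range V = closure (range T) \<and>
    null_space V = null_space T" using V by blast
  fix W assume W: "partial_isometry W \<and> T = W o\<^sub>L op_abs T \<and> range W = closure (range T) \<and>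
    null_space W = null_space T"
  have sM: "sym_op (op_abs T)" using op_abs(1)[OF T] by (simp add: pos_ops_iff psd_op_sym)
  have clo: "closure (range (op_abs T)) \<subseteq> {u. W u = V u}"
  proof (rule closure_minimal)
    show "range (op_abs T) \<subseteq> {u. W u = V u}"
    proof -
      have "W (op_abs T x) = V (op_abs T x)" for x
        using V(2) W by (metis blinfun_apply_blinfun_compose)
      then show ?thesis by blast
    qed
    show "closed {u. W u = V u}" by (intro closed_Collect_eq continuous_intros)
  qed
  show "W = V"
  proof (rule blinfun_eqI)
    fix x
    obtain u where u: "u \<in> closure (range (op_abs T))"
      "\<And>v. v \<in> closure (range (op_abs T)) \<Longrightarrow> inner (x - u) v = 0"
      using orthogonal_decomposition[OF subspace_closure_range_blinfun closed_closure, where x = x]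
      by blast
    have "op_abs T (x - u) = 0"
      unfolding sym_op_null_iff[OF sM] inner_commute[of _ "x - u"]
      using u(2) closure_subset by blast
    then have "x - u \<in> null_space T" by (simp add: null_space_def null_op_pos_neg_iff(2)[OF T])
    then have "W (x - u) = 0" "V (x - u) = 0" using V(4) W by (auto simp: null_space_def)
    then show "W x = V x" using u(1) clo by (auto simp: blinfun.diff_right)
  qed
qed

text \<open>Subtracting from \<open>x\<close> its projections onto both ranges leaves a vector
  killed by both parts, hence by \<open>T\<close>. What was subtracted is orthogonal to the null
  space, so the remainder is the projection onto it.\<close>

lemma selfadj_cr_projections:
  assumes T: "T \<in> selfadj_cr_ops"
  shows "closed_csubspace (range (op_pos T))" "closed_csubspace (range (op_neg T))"
    "closed_csubspace (null_space T)"
    "op_proj (range (op_pos T)) x + op_proj (range (op_neg T)) x + op_proj (null_space T) x = x"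
    "op_proj (range (op_pos T)) (op_neg T x) = 0" "op_proj (range (op_neg T)) (op_pos T x) = 0"
proof -
  have sT: "T \<in> selfadj_ops" and cl: "closed (range T)" using T by (auto simp: selfadj_cr_ops_def)
  note pn = op_pos_neg_in_pos_ops[OF sT] and sym = sym_op_pos_neg[OF sT]
    and orth = op_pos_neg_compose[OF sT]
  show V1: "closed_csubspace (range (op_pos T))" and V2: "closed_csubspace (range (op_neg T))"
    using closed_csubspace_range pn cl closed_range_iff_op_pos_neg[OF sT]
    by (auto simp: pos_ops_iff)
  show V0: "closed_csubspace (null_space T)"
    using sT by (simp add: closed_csubspace_null_space selfadj_ops_iff)
  let ?p = "op_proj (range (op_pos T)) x" and ?n = "op_proj (range (op_neg T)) x"
  obtain a b where ab: "?p = op_pos T a" "?n = op_neg T b"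
    using op_proj_in[OF V1, of x] op_proj_in[OF V2, of x] by blast
  have "op_pos T (x - ?p) = 0" "op_neg T (x - ?n) = 0"
    unfolding sym_op_null_iff[OF sym(1)] sym_op_null_iff[OF sym(2)]
    using op_proj_orthogonal[OF V1] op_proj_orthogonal[OF V2] by (auto simp: inner_commute)
  then have "op_pos T (x - ?p - ?n) = 0" "op_neg T (x - ?p - ?n) = 0"
    using ab orth by (simp_all add: blinfun.diff_right)
  then have "x - ?p - ?n \<in> null_space T"
    by (simp add: null_space_def null_op_pos_neg_iff(1)[OF sT])
  moreover have "inner (x - (x - ?p - ?n)) v = 0" if "v \<in> null_space T" for v
    using that by (simp add: null_space_def null_op_pos_neg_iff(1)[OF sT] ab inner_add_left
        sym_opD[OF sym(1)] sym_opD[OF sym(2)])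
  ultimately have "op_proj (null_space T) x = x - ?p - ?n" by (rule op_proj_eqI[OF V0])
  then show "?p + ?n + op_proj (null_space T) x = x" by simp
  show "op_proj (range (op_pos T)) (op_neg T x) = 0" "op_proj (range (op_neg T)) (op_pos T x) = 0"
    using orth by (auto intro!: op_proj_eq_0 V1 V2 simp: sym_opD[OF sym(1)] sym_opD[OF sym(2)])
qed

lemma polar_factor_selfadj_cr:
  assumes T: "T \<in> selfadj_cr_ops"
  shows "polar_factor T = op_proj (range (op_pos T)) - op_proj (range (op_neg T))"
proof (rule polar_factor_eqI)
  show sT: "T \<in> selfadj_ops" using T by (simp add: selfadj_cr_ops_def)
  have cl: "closed (range T)" using T by (simp add: selfadj_cr_ops_def)
  note V = selfadj_cr_projections(1-3)[OF T] and sum = selfadj_cr_projections(4)[OF T]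
    and kill = selfadj_cr_projections(5,6)[OF T]
  note sym = sym_op_pos_neg[OF sT] and orth = op_pos_neg_compose[OF sT]
  define P where "P = op_proj (range (op_pos T))"
  define N where "N = op_proj (range (op_neg T))"
  define Z where "Z = op_proj (null_space T)"
  have PN: "P (N x) = 0" "N (P x) = 0" "P (P x) = P x" "N (N x) = N x" for x
    using op_proj_in[OF V(1), of x] op_proj_in[OF V(2), of x] kill
    by (auto simp: P_def N_def op_proj_eq_self[OF V(1)] op_proj_eq_self[OF V(2)])
  have innPN: "inner (P x) (N y) = 0" for x y
    using op_proj_in[OF V(1), of x] op_proj_in[OF V(2), of y] orth
    by (auto simp: P_def N_def sym_opD[OF sym(1)])
  \<comment> \<open>Changing the sign of one of two orthogonal vectors preserves the norm of the
    sum; and \<open>P x + N x = x\<close> for \<open>x\<close> orthogonal to the null space.\<close>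
  have sq: "(norm ((P - N) x))\<^sup>2 = (norm (P x + N x))\<^sup>2" for x
    using innPN[of x x]
    by (simp add: power2_norm_eq_inner blinfun.diff_left inner_simps inner_commute)
  have nullT: "P v = 0 \<and> N v = 0" if "T v = 0" for v
    using that null_op_pos_neg_iff(1)[OF sT] unfolding P_def N_def
    by (auto intro!: op_proj_eq_0 V simp: sym_op_null_iff[OF sym(1)] sym_op_null_iff[OF sym(2)]
      inner_commute)
  show null: "null_space (P - N) = null_space T"
  proof (intro subset_antisym subsetI)
    fix x assume "x \<in> null_space (P - N)"
    then have "P x = N x" by (simp add: null_space_def blinfun.diff_left)
    then have "P x = 0" "N x = 0" using innPN[of x x] by simp_all
    then have "x = Z x" using sum[of x] by (simp add: P_def N_def Z_def)
    then show "x \<in> null_space T" using op_proj_in[OF V(3), of x] by (simp add: Z_def)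
  next
    fix x assume "x \<in> null_space T"
    then show "x \<in> null_space (P - N)" using nullT by (simp add: null_space_def blinfun.diff_left)
  qed
  have orthZ: "P x + N x = x" if "\<And>v. v \<in> null_space T \<Longrightarrow> inner x v = 0" for x
    using sum[of x] op_proj_eq_0[OF V(3) that] by (simp add: P_def N_def)
  show "partial_isometry (P - N)"
    unfolding partial_isometry_def null
  proof (intro conjI allI impI)
    show "P - N \<in> bounded_ops"
      by (simp add: P_def N_def bounded_ops_closed(2) op_proj_bounded_ops V)
    fix x assume "\<forall>y\<in>null_space T. cinner x y = 0"
    then have "P x + N x = x" by (intro orthZ) (simp add: inner_eq_Re_cinner)
    then show "norm ((P - N) x) = norm x" using sq[of x] by (simp add: power2_eq_iff_nonneg)
  qed
  show "T = (P - N) o\<^sub>L op_abs T"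
  proof (rule blinfun_eqI)
    fix x
    have "P (op_pos T x) = op_pos T x" "N (op_neg T x) = op_neg T x"
      by (simp_all add: P_def N_def op_proj_eq_self[OF V(1)] op_proj_eq_self[OF V(2)])
    then have "(P - N) ((op_pos T + op_neg T) x) = (op_pos T - op_neg T) x"
      using kill by (simp add: P_def N_def blinfun.add_left blinfun.diff_left blinfun.add_right)
    then show "T x = ((P - N) o\<^sub>L op_abs T) x"
      by (simp add: op_pos_plus_op_neg op_pos_minus_op_neg)
  qed
  have symT: "sym_op T" using sT by (simp add: selfadj_ops_iff)
  show "range (P - N) = closure (range T)"
    unfolding closure_closed[OF cl]
  proof (intro subset_antisym subsetI)
    fix y assume "y \<in> range (P - N)"
    then obtain x where y: "y = P x - N x" by (auto simp: blinfun.diff_left)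
    obtain a b where "P x = op_pos T a" "N x = op_neg T b"
      using op_proj_in[OF V(1), of x] op_proj_in[OF V(2), of x] by (auto simp: P_def N_def)
    then show "y \<in> range T"
      unfolding sym_op_range_iff[OF symT cl] y
      by (simp add: null_op_pos_neg_iff(1)[OF sT] inner_diff_left sym_opD[OF sym(1)] sym_opD[OF sym(2)])
  next
    fix y assume "y \<in> range T"
    then have "P y + N y = y"
      by (intro orthZ) (auto simp: null_space_def sym_opD[OF symT])
    \<comment> \<open>\<open>P - N\<close> is its own inverse on the range of \<open>T\<close>, so
      \<open>y\<close> is the image of its own image.\<close>
    then have "y = (P - N) (P y - N y)"
      by (simp add: blinfun.diff_left blinfun.diff_right PN)
    then show "y \<in> range (P - N)" by blast
  qed
qed

lemma op_reflection_selfadj_cr: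
  assumes T: "T \<in> selfadj_cr_ops"
  shows "op_reflection T = op_proj (range (op_pos T)) - op_proj (range (op_neg T))
    + op_proj (null_space T)"
  by (simp add: op_reflection_def polar_factor_selfadj_cr[OF T])

lemma op_reflection_eq_iff:
  assumes S: "S \<in> selfadj_cr_ops" and T: "T \<in> selfadj_cr_ops"
    and null: "null_space S = null_space T"
  shows "op_reflection S = op_reflection T \<longleftrightarrow>
    range (op_pos T) = range (op_pos S) \<and> range (op_neg T) = range (op_neg S)"
proof
  note VS = selfadj_cr_projections(1,2)[OF S] and VT = selfadj_cr_projections(1,2)[OF T]
  assume "op_reflection S = op_reflection T"
  then have diff: "op_proj (range (op_pos S)) - op_proj (range (op_neg S))
      = op_proj (range (op_pos T)) - op_proj (range (op_neg T))"
    by (simp add: op_reflection_selfadj_cr S T null)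
  have "op_proj (range (op_pos S)) x = op_proj (range (op_pos T)) x \<and>
      op_proj (range (op_neg S)) x = op_proj (range (op_neg T)) x" for x
  proof -
    have d: "op_proj (range (op_pos S)) x - op_proj (range (op_neg S)) x
        = op_proj (range (op_pos T)) x - op_proj (range (op_neg T)) x"
      using arg_cong[OF diff, of "\<lambda>B. blinfun_apply B x"] by (simp add: blinfun.diff_left)
    have s: "op_proj (range (op_pos S)) x + op_proj (range (op_neg S)) x
        = op_proj (range (op_pos T)) x + op_proj (range (op_neg T)) x"
      using selfadj_cr_projections(4)[OF S, of x] selfadj_cr_projections(4)[OF T, of x]
      by (metis null add_right_imp_eq)
    have "a = c \<and> b = d" if "a - b = c - d" "a + b = c + d" for a b c d :: 'a
    proof -
      have "a + a = c + c" using arg_cong2[OF that, of plus] by (simp add: algebra_simps)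
      then have "2 *\<^sub>R a = 2 *\<^sub>R c" by (simp add: scaleR_2)
      then show ?thesis using that by simp
    qed
    from this[OF d s] show ?thesis .
  qed
  then have "op_proj (range (op_pos S)) = op_proj (range (op_pos T))"
    "op_proj (range (op_neg S)) = op_proj (range (op_neg T))"
    by (auto intro: blinfun_eqI)
  then show "range (op_pos T) = range (op_pos S) \<and> range (op_neg T) = range (op_neg S)"
    using range_op_proj[OF VS(1)] range_op_proj[OF VS(2)] range_op_proj[OF VT(1)]
      range_op_proj[OF VT(2)] by metis
qed (simp add: op_reflection_selfadj_cr S T null)

subsection \<open>Thompson components\<close>

lemma thompson_component_iff:
  assumes S: "S \<in> selfadj_cr_ops"
  shows "T \<in> thompson_component S \<longleftrightarrow> T \<in> selfadj_cr_ops \<and>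
    range (op_pos T) = range (op_pos S) \<and> range (op_neg T) = range (op_neg S)"
proof (cases "T \<in> selfadj_ops")
  case T: True
  have sS: "S \<in> selfadj_ops" using S by (simp add: selfadj_cr_ops_def)
  have clS: "closed (range (op_pos S))" "closed (range (op_neg S))"
    using S closed_range_iff_op_pos_neg[OF sS] by (simp_all add: selfadj_cr_ops_def)
  note pT = op_pos_neg_in_pos_ops[OF T] and pS = op_pos_neg_in_pos_ops[OF sS]
  \<comment> \<open>Only \<open>B\<close> is known to have closed range. Then so has its root, and
    equality on either side makes the range of \<open>op_sqrt A\<close> or of \<open>A\<close>
    closed, which is enough for \<open>range_op_sqrt\<close>.\<close>
  have "range (op_sqrt A) = range (op_sqrt B) \<longleftrightarrow> range A = range B"
    if "A \<in> pos_ops" "B \<in> pos_ops" "closed (range B)" for A B :: "'a \<Rightarrow>\<^sub>L 'a"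
    using range_op_sqrt[of A] range_op_sqrt[of B] that by metis
  from this[OF pT(1) pS(1) clS(1)] this[OF pT(2) pS(2) clS(2)] show ?thesis
    using T clS closed_range_iff_op_pos_neg[OF T]
    by (auto simp: thompson_component_def selfadj_cr_ops_def)
qed (simp add: thompson_component_def selfadj_cr_ops_def)

lemma loewner_le_null:
  assumes "A \<in> pos_ops" "A \<preceq> B" "B x = 0"
  shows "A x = 0"
proof (rule psd_op_inner_eq_0D)
  show p: "psd_op A" using assms(1) by (simp add: pos_ops_iff)
  have "inner (A x) x \<le> inner (B x) x" using assms(2) by (simp add: loewner_le_iff)
  then show "inner (A x) x = 0" using psd_opD[OF p, of x] assms(3) by simp
qed

lemma pos_ops_add: "A \<in> pos_ops \<Longrightarrow> B \<in> pos_ops \<Longrightarrow> A + B \<in> pos_ops"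
  by (auto simp: pos_ops_iff bounded_ops_closed psd_op_def sym_op_def blinfun.add_left
      inner_add_left inner_add_right)

lemma pos_ops_scaleR: "A \<in> pos_ops \<Longrightarrow> 0 \<le> r \<Longrightarrow> r *\<^sub>R A \<in> pos_ops"
  by (simp add: pos_ops_iff bounded_ops_scaleR psd_op_scaleR)

lemma pos_ops_add_null:
  assumes A: "A \<in> pos_ops" and B: "B \<in> pos_ops" and "A x + B x = 0"
  shows "A x = 0" "B x = 0"
proof -
  have "inner (A x) x + inner (B x) x = 0" by (metis assms(3) inner_add_left inner_zero_left)
  then have "inner (A x) x = 0" "inner (B x) x = 0"
    using A B psd_opD[of A x] psd_opD[of B x] by (simp_all add: pos_ops_iff)
  then show "A x = 0" "B x = 0" using A B psd_op_inner_eq_0D by (auto simp: pos_ops_iff)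
qed

lemma loewner_le_scaleR_mono:
  assumes "A \<preceq> l *\<^sub>R B" "B \<in> pos_ops" "l \<le> m"
  shows "A \<preceq> m *\<^sub>R B"
  unfolding loewner_le_iff
proof
  fix x
  have "inner (A x) x \<le> l * inner (B x) x"
    using assms(1) by (simp add: loewner_le_iff blinfun.scaleR_left)
  also have "\<dots> \<le> m * inner (B x) x"
    using assms(2,3) by (intro mult_right_mono) (simp_all add: pos_ops_iff psd_opD)
  finally show "inner (A x) x \<le> inner ((m *\<^sub>R B) x) x" by (simp add: blinfun.scaleR_left)
qed

lemma loewner_le_inverse_scaleR:
  assumes "A \<preceq> l *\<^sub>R B" "l > 0"
  shows "(1 / l) *\<^sub>R A \<preceq> B"
  using assms by (simp add: loewner_le_iff blinfun.scaleR_left pos_divide_le_eq mult.commute)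

lemma thompson_component_iff_loewner:
  assumes S: "S \<in> selfadj_cr_ops"
  shows "T \<in> thompson_component S \<longleftrightarrow> T \<in> selfadj_cr_ops \<and> op_reflection S = op_reflection T \<and>
    (\<exists>l1 l2 :: real. l1 > 0 \<and> l2 > 0 \<and>
      op_abs S \<preceq> l1 *\<^sub>R op_pos T + l2 *\<^sub>R op_neg T \<and>
      (1 / l1) *\<^sub>R op_pinv (op_pos T) + (1 / l2) *\<^sub>R op_pinv (op_neg T) \<preceq> op_pinv (op_abs S))"
proof (cases "T \<in> selfadj_cr_ops")
  case T: True
  have sS: "S \<in> selfadj_ops" and clS: "closed (range S)"
    and sT: "T \<in> selfadj_ops" and clT: "closed (range T)"
    using S T by (simp_all add: selfadj_cr_ops_def)
  note pT = op_pos_neg_in_pos_ops[OF sT]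
  have clTpn: "closed (range (op_pos T))" "closed (range (op_neg T))"
    using clT closed_range_iff_op_pos_neg[OF sT] by simp_all
  have absS: "op_abs S \<in> pos_ops" and absT: "op_abs T \<in> pos_ops"
    and clabsS: "closed (range (op_abs S))" and clabsT: "closed (range (op_abs T))"
    by (simp_all add: op_abs(1) range_op_abs sS sT clS clT)
  have pos_selfadj: "A \<in> selfadj_ops" if "A \<in> pos_ops" for A :: "'a \<Rightarrow>\<^sub>L 'a"
    using that by (simp add: pos_ops_def)
  let ?Sd = "op_pinv (op_abs S)" and ?Pd = "op_pinv (op_pos T)" and ?Nd = "op_pinv (op_neg T)"
  have pinvS: "?Sd \<in> pos_ops" "closed (range ?Sd)" "?Sd x = 0 \<longleftrightarrow> S x = 0" for x
    using op_pinv[OF pos_selfadj[OF absS] clabsS] absS clabsS null_op_pos_neg_iff(2)[OF sS] by simp_all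
  have pinvP: "?Pd \<in> pos_ops" "?Pd x = 0 \<longleftrightarrow> op_pos T x = 0" for x
    using op_pinv[OF pos_selfadj[OF pT(1)] clTpn(1)] pT by simp_all
  have pinvN: "?Nd \<in> pos_ops" "?Nd x = 0 \<longleftrightarrow> op_neg T x = 0" for x
    using op_pinv[OF pos_selfadj[OF pT(2)] clTpn(2)] pT by simp_all
  note nullS = null_op_pos_neg_iff[OF sS] and nullT = null_op_pos_neg_iff[OF sT]
  show ?thesis
  proof
    assume "T \<in> thompson_component S"
    then have ranges: "range (op_pos T) = range (op_pos S)" "range (op_neg T) = range (op_neg S)"
      using thompson_component_iff[OF S] by simp_all
    then have null: "S x = 0 \<longleftrightarrow> T x = 0" for x
      unfolding nullS(1) nullT(1)
      by (simp add: sym_op_null_iff sym_op_pos_neg[OF sS] sym_op_pos_neg[OF sT])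
    then have refl: "op_reflection S = op_reflection T"
      using op_reflection_eq_iff[OF S T] ranges by (simp add: null_space_def)
    obtain a where a: "a > 0" "op_abs S \<preceq> a *\<^sub>R op_abs T"
      using loewner_le_scaleR_exists[OF absS absT clabsT] nullS(2) nullT(2) null by blast
    have "?Pd + ?Nd \<in> pos_ops" using pinvP(1) pinvN(1) by (rule pos_ops_add)
    moreover have "(?Pd + ?Nd) x = 0" if "?Sd x = 0" for x
    proof -
      have "?Pd x = 0" "?Nd x = 0"
        using that by (simp_all add: pinvS(3) pinvP(2) pinvN(2) null nullT(1))
      then show ?thesis by (simp add: blinfun.add_left)
    qed
    ultimately obtain b where b: "b > 0" "?Pd + ?Nd \<preceq> b *\<^sub>R ?Sd"
      using loewner_le_scaleR_exists[OF _ pinvS(1,2)] by blast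
    \<comment> \<open>Enlarging the constant weakens both inequalities, the second one after
      division by it, so the maximum serves for both and also as \<open>l1 = l2\<close>.\<close>
    define l where "l = max a b"
    have l: "l > 0" using a(1) by (simp add: l_def)
    have "op_abs S \<preceq> l *\<^sub>R op_abs T"
      by (rule loewner_le_scaleR_mono[OF a(2) absT]) (simp add: l_def)
    moreover have "?Pd + ?Nd \<preceq> l *\<^sub>R ?Sd"
      by (rule loewner_le_scaleR_mono[OF b(2) pinvS(1)]) (simp add: l_def)
    then have "(1 / l) *\<^sub>R (?Pd + ?Nd) \<preceq> ?Sd" using l by (rule loewner_le_inverse_scaleR)
    ultimately show "T \<in> selfadj_cr_ops \<and> op_reflection S = op_reflection T \<and>
      (\<exists>l1 l2 :: real. l1 > 0 \<and> l2 > 0 \<and>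
        op_abs S \<preceq> l1 *\<^sub>R op_pos T + l2 *\<^sub>R op_neg T \<and>
        (1 / l1) *\<^sub>R ?Pd + (1 / l2) *\<^sub>R ?Nd \<preceq> ?Sd)"
      using T refl l
      by (intro conjI exI[of _ l]) (simp_all add: scaleR_add_right flip: op_pos_plus_op_neg)
  next
    assume R: "T \<in> selfadj_cr_ops \<and> op_reflection S = op_reflection T \<and>
      (\<exists>l1 l2 :: real. l1 > 0 \<and> l2 > 0 \<and>
        op_abs S \<preceq> l1 *\<^sub>R op_pos T + l2 *\<^sub>R op_neg T \<and>
        (1 / l1) *\<^sub>R ?Pd + (1 / l2) *\<^sub>R ?Nd \<preceq> ?Sd)"
    then obtain l1 l2 :: real where l: "l1 > 0" "l2 > 0"
      and le1: "op_abs S \<preceq> l1 *\<^sub>R op_pos T + l2 *\<^sub>R op_neg T"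
      and le2: "(1 / l1) *\<^sub>R ?Pd + (1 / l2) *\<^sub>R ?Nd \<preceq> ?Sd" by blast
    have "S x = 0 \<longleftrightarrow> T x = 0" for x
    proof
      assume "T x = 0"
      then have "(l1 *\<^sub>R op_pos T + l2 *\<^sub>R op_neg T) x = 0"
        using nullT(1) by (simp add: blinfun.add_left blinfun.scaleR_left)
      from loewner_le_null[OF absS le1 this] show "S x = 0" using nullS(2) by simp
    next
      assume "S x = 0"
      then have "?Sd x = 0" by (simp add: pinvS(3))
      have pos: "(1 / l1) *\<^sub>R ?Pd \<in> pos_ops" "(1 / l2) *\<^sub>R ?Nd \<in> pos_ops"
        using l by (simp_all add: pos_ops_scaleR pinvP(1) pinvN(1))
      from loewner_le_null[OF pos_ops_add[OF pos] le2 \<open>?Sd x = 0\<close>]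
      have "((1 / l1) *\<^sub>R ?Pd) x + ((1 / l2) *\<^sub>R ?Nd) x = 0" by (simp add: blinfun.add_left)
      from pos_ops_add_null[OF pos this] have "?Pd x = 0" "?Nd x = 0"
        using l by (simp_all add: blinfun.scaleR_left)
      then show "T x = 0" by (simp add: pinvP(2) pinvN(2) nullT(1))
    qed
    then have "null_space S = null_space T" by (simp add: null_space_def)
    then show "T \<in> thompson_component S"
      using R op_reflection_eq_iff[OF S T] thompson_component_iff[OF S] by simp
  qed
qed (simp add: thompson_component_iff[OF S])

text \<open>The negative part of \<open>S\<close> is 0, so equality of ranges forces
  \<open>op_neg T = 0\<close>, and \<open>T\<close> is its own positive part.\<close>

lemma thompson_component_pos_iff:
  assumes S: "S \<in> pos_cr_ops"
  shows "T \<in> thompson_component S \<longleftrightarrow> T \<in> pos_cr_ops \<and> range T = range S"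
proof -
  have pS: "S \<in> pos_ops" and scr: "S \<in> selfadj_cr_ops"
    using S by (auto simp: pos_cr_ops_def pos_ops_def selfadj_cr_ops_def)
  have parts: "op_pos A = A" "op_neg A = 0" if "A \<in> pos_ops" for A :: "'a \<Rightarrow>\<^sub>L 'a"
    using op_abs_pos[OF that] by (simp_all add: op_pos_def op_neg_def)
  have "T \<in> pos_ops" if "T \<in> selfadj_ops" "range (op_neg T) = range (op_neg S)"
  proof -
    have "op_neg T = 0"
      using that(2) by (intro blinfun_eqI) (auto simp: parts[OF pS])
    then have "op_pos T = T" using op_pos_minus_op_neg[of T] by simp
    then show ?thesis using op_pos_neg_in_pos_ops(1)[OF that(1)] by simp
  qed
  then show ?thesis
    unfolding thompson_component_iff[OF scr]
    by (auto simp: selfadj_cr_ops_def pos_cr_ops_def pos_ops_def parts[OF pS])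
      (auto simp: parts pos_ops_def)
qed

lemma pos_cr_ops_range_eq_iff:
  assumes S: "S \<in> pos_cr_ops" and T: "T \<in> pos_cr_ops"
  shows "range T = range S \<longleftrightarrow>
    (\<exists>l :: real. l > 0 \<and> S \<preceq> l *\<^sub>R T \<and> (1 / l) *\<^sub>R op_pinv T \<preceq> op_pinv S)"
proof -
  have pS: "S \<in> pos_ops" "closed (range S)" and pT: "T \<in> pos_ops" "closed (range T)"
    using S T by (simp_all add: pos_cr_ops_def)
  then have sS: "S \<in> selfadj_ops" "sym_op S" and sT: "T \<in> selfadj_ops" "sym_op T"
    by (simp_all add: pos_ops_def selfadj_ops_iff)
  note dS = op_pinv[OF sS(1) pS(2)] and dT = op_pinv[OF sT(1) pT(2)]
  show ?thesis
  proof
    assume "range T = range S"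
    then have null: "S x = 0 \<longleftrightarrow> T x = 0" for x by (simp add: sym_op_null_iff sS sT)
    obtain a where a: "a > 0" "S \<preceq> a *\<^sub>R T"
      using loewner_le_scaleR_exists[OF pS(1) pT] null by blast
    \<comment> \<open>The pseudoinverses are positive with the same null spaces and ranges as
      \<open>T\<close> and \<open>S\<close>, so the domination result applies to them with the roles
      exchanged.\<close>
    obtain b where b: "b > 0" "op_pinv T \<preceq> b *\<^sub>R op_pinv S"
      using loewner_le_scaleR_exists[OF dT(4)[OF pT(1)] dS(4)[OF pS(1)]] null dS(2,3) dT(3) pS(2)
      by metis
    define l where "l = max a b"
    have l: "l > 0" using a(1) by (simp add: l_def)
    have "S \<preceq> l *\<^sub>R T" by (rule loewner_le_scaleR_mono[OF a(2) pT(1)]) (simp add: l_def)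
    moreover have "op_pinv T \<preceq> l *\<^sub>R op_pinv S"
      by (rule loewner_le_scaleR_mono[OF b(2) dS(4)[OF pS(1)]]) (simp add: l_def)
    then have "(1 / l) *\<^sub>R op_pinv T \<preceq> op_pinv S" using l by (rule loewner_le_inverse_scaleR)
    ultimately show "\<exists>l :: real. l > 0 \<and> S \<preceq> l *\<^sub>R T \<and> (1 / l) *\<^sub>R op_pinv T \<preceq> op_pinv S"
      using l by blast
  next
    assume "\<exists>l :: real. l > 0 \<and> S \<preceq> l *\<^sub>R T \<and> (1 / l) *\<^sub>R op_pinv T \<preceq> op_pinv S"
    then obtain l :: real where l: "l > 0" "S \<preceq> l *\<^sub>R T" "(1 / l) *\<^sub>R op_pinv T \<preceq> op_pinv S"
      by blast
    have "S x = 0 \<longleftrightarrow> T x = 0" for x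
    proof
      assume "T x = 0"
      then show "S x = 0"
        by (intro loewner_le_null[OF pS(1) l(2)]) (simp add: blinfun.scaleR_left)
    next
      assume "S x = 0"
      have "(1 / l) *\<^sub>R op_pinv T \<in> pos_ops"
        using l(1) dT(4)[OF pT(1)] by (simp add: pos_ops_scaleR)
      from loewner_le_null[OF this l(3)] have "op_pinv T x = 0"
        using \<open>S x = 0\<close> l(1) by (simp add: blinfun.scaleR_left dS(3))
      then show "T x = 0" by (simp add: dT(3))
    qed
    then show "range T = range S"
      using sym_op_range_iff[OF sS(2) pS(2)] sym_op_range_iff[OF sT(2) pT(2)] by blast
  qed
qed

theorem proposition4p13:
  fixes S :: "'a::complex_hilbert \<Rightarrow>\<^sub>L 'a"
  shows "(S \<in> selfadj_cr_ops \<longrightarrow>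
      thompson_component S =
        {T \<in> selfadj_cr_ops. op_reflection S = op_reflection T \<and>
          (\<exists>l1 l2 :: real. l1 > 0 \<and> l2 > 0 \<and>
            op_abs S \<preceq> l1 *\<^sub>R op_pos T + l2 *\<^sub>R op_neg T \<and>
            (1 / l1) *\<^sub>R op_pinv (op_pos T) + (1 / l2) *\<^sub>R op_pinv (op_neg T)
              \<preceq> op_pinv (op_abs S))})
    \<and> (S \<in> pos_cr_ops \<longrightarrow>
      thompson_component S =
        {T \<in> pos_cr_ops. \<exists>l :: real. l > 0 \<and>
          S \<preceq> l *\<^sub>R T \<and> (1 / l) *\<^sub>R op_pinv T \<preceq> op_pinv S})"
proof (intro conjI impI set_eqI)
  fix T
  assume "S \<in> selfadj_cr_ops"
  from thompson_component_iff_loewner[OF this]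
  show "T \<in> thompson_component S \<longleftrightarrow>
    T \<in> {T \<in> selfadj_cr_ops. op_reflection S = op_reflection T \<and>
          (\<exists>l1 l2 :: real. l1 > 0 \<and> l2 > 0 \<and>
            op_abs S \<preceq> l1 *\<^sub>R op_pos T + l2 *\<^sub>R op_neg T \<and>
            (1 / l1) *\<^sub>R op_pinv (op_pos T) + (1 / l2) *\<^sub>R op_pinv (op_neg T)
              \<preceq> op_pinv (op_abs S))}" by blast
next
  fix T
  assume S: "S \<in> pos_cr_ops"
  show "T \<in> thompson_component S \<longleftrightarrow>
    T \<in> {T \<in> pos_cr_ops. \<exists>l :: real. l > 0 \<and>
          S \<preceq> l *\<^sub>R T \<and> (1 / l) *\<^sub>R op_pinv T \<preceq> op_pinv S}"
    using thompson_component_pos_iff[OF S] pos_cr_ops_range_eq_iff[OF S] by blast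
qed

end
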